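(* Let $k>3$. Let $P_1,\dots,P_k$ be $k$ distinct collinear points in $\mathbb{P}^2$ (over $\mathbb{C}$), and for each $i$ let $\ell_i$ and $m_i$ be lines through $P_i$. Put $\mathcal{C}=\ell_1\cup\dots\cup\ell_k$ and $\mathcal{D}=m_1\cup\dots\cup m_k$, and suppose that the lines are chosen so that $\mathcal{C}\cap\mathcal{D}$ consists of $k^2$ distinct points and the only collinearities among these $k^2$ points are those given by the lines $\ell_i$, the lines $m_i$, and the line containing $P_1,\dots,P_k$. Let $\mathscr{M}_{k^2}$ be the matroid associated to the $3\times k^2$ matrix whose columns are homogeneous coordinates of the points of $\mathcal{C}\cap\mathcal{D}$, let $\mathcal{V}_{k^2}\subset \mathrm{Gr}(3,k^2)$ be the associated matroid variety, and let $I_{k^2}$ be its ideal. Then there is a nontrivial polynomial of degree $\binom{k+1}{3}$ in $I_{k^2}$.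
   Context: For $x\in \mathrm{Gr}(r,n)$ (the Grassmannian of $r$-dimensional subspaces of $\mathbb{C}^n$), let $A_x$ be any $r\times n$ matrix whose rows form a basis of the subspace $x$. The matroid $\mathscr{M}_x$ associated to $A_x$ is the matroid on $\Omega_n=\{1,\dots,n\}$ whose bases are the sets $\lambda$ of $r$ indices such that the columns of $A_x$ indexed by $\lambda$ are linearly independent. $\Gamma_x=\{y\in \mathrm{Gr}(r,n): \mathscr{M}_y=\mathscr{M}_x\}$ and the associated matroid variety is the Zariski closure $\mathcal{V}_x=\overline{\Gamma_x}\subset \mathrm{Gr}(r,n)$. For an $r$-element subset $\lambda=\{\lambda_1<\dots<\lambda_r\}$ of $\Omega_n$, the bracket $[\lambda]=[\lambda_1\cdots\lambda_r]$ is the Plücker coordinate given by the $r\times r$ minor on the columns $\lambda_1,\dots,\lambda_r$. $\mathbb{C}[\mathrm{Gr}(r,n)]$ is the homogeneous coordinate ring of the Grassmannian in its Plücker embedding, i.e. the polynomial ring in the brackets modulo the ideal of Plücker relations, graded so that each bracket has degree $1$; degrees of polynomials are degrees in the brackets. $I_x\subset\mathbb{C}[\mathrm{Gr}(r,n)]$ is the ideal of all elements vanishing on $\mathcal{V}_x$, and $N_x\subseteq I_x$ is the ideal generated by the brackets $[\lambda]$ with $\lambda$ an $r$-element subset of $\Omega_n$ that is not a basis of $\mathscr{M}_x$. An element of $\mathbb{C}[\mathrm{Gr}(r,n)]$ is nontrivial (for $\mathscr{M}_x$) if it lies in $I_x$ but not in $N_x$. Here $r=3$, $n=k^2$, and $x$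 is the row span of the $3\times k^2$ matrix in the claim. *)

theory Defs
  imports
    "HOL-Library.Poly_Mapping"
    "HOL-Algebra.QuotRing"
    "Jordan_Normal_Form.VS_Connect"
    "Jordan_Normal_Form.Determinant"
    "Jordan_Normal_Form.DL_Submatrix"
begin

text \<open>
  Vectors and matrices are indexed from 0, so the ground set \<open>{1, \<dots>, n}\<close> of the matroids and
  of the brackets becomes \<open>{..<n}\<close>.
\<close>

section \<open>Grassmannians and matroids\<close>

abbreviation cspace :: "nat \<Rightarrow> (complex, complex vec) module" where
  "cspace n \<equiv> module_vec TYPE(complex) n"

definition Gr :: "nat \<Rightarrow> nat \<Rightarrow> complex vec set set" where
  "Gr r n = {W. VectorSpace.subspace class_ring W (cspace n) \<and>
                vectorspace.dim class_ring (cspace n\<lparr>carrier := W\<rparr>) = r}"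

definition basis_matrix :: "nat \<Rightarrow> nat \<Rightarrow> complex vec set \<Rightarrow> complex mat \<Rightarrow> bool" where
  "basis_matrix r n x A \<longleftrightarrow> A \<in> carrier_mat r n \<and> distinct (rows A) \<and>
     vectorspace.basis class_ring (cspace n\<lparr>carrier := x\<rparr>) (set (rows A))"

text \<open>
  A matroid is given by its ground set and its set of bases. The injectivity condition makes this
  independence of the columns as a family: equal columns at different indices are dependent.
\<close>

definition column_matroid :: "complex mat \<Rightarrow> nat set \<times> nat set set" where
  "column_matroid A = ({..<dim_col A},
     {l. l \<subseteq> {..<dim_col A} \<and> card l = dim_row A \<and> inj_on (col A) l \<and>
         \<not> LinearCombinations.module.lin_dep class_ring (cspace (dim_row A)) (col A ` l)})"

text \<open>Any other choice of basis matrix yields the same matroid.\<close>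

definition matroid_of :: "nat \<Rightarrow> nat \<Rightarrow> complex vec set \<Rightarrow> nat set \<times> nat set set" where
  "matroid_of r n x = column_matroid (SOME A. basis_matrix r n x A)"

section \<open>The homogeneous coordinate ring of the Grassmannian\<close>

text \<open>
  Monomials in the brackets are exponent functions \<open>nat set \<Rightarrow>\<^sub>0 nat\<close>; the ambient type allows every
  set of naturals as a variable, and the carrier of the ring restricts to the \<open>r\<close>-element subsets
  of \<open>{..<n}\<close>.
\<close>

type_synonym bracket_poly = "(nat set \<Rightarrow>\<^sub>0 nat) \<Rightarrow>\<^sub>0 complex"

definition bracket_indices :: "nat \<Rightarrow> nat \<Rightarrow> nat set set" where
  "bracket_indices r n = {l. l \<subseteq> {..<n} \<and> card l = r}"

definition bracket :: "nat set \<Rightarrow> bracket_poly" where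
  "bracket l = Poly_Mapping.single (Poly_Mapping.single l 1) 1"

definition bracket_ring :: "nat \<Rightarrow> nat \<Rightarrow> bracket_poly ring" where
  "bracket_ring r n =
     \<lparr>carrier = {f. \<forall>m \<in> Poly_Mapping.keys f. Poly_Mapping.keys m \<subseteq> bracket_indices r n},
      monoid.mult = (*), one = 1, zero = 0, add = (+)\<rparr>"

definition bracket_homogeneous :: "nat \<Rightarrow> bracket_poly \<Rightarrow> bool" where
  "bracket_homogeneous d f \<longleftrightarrow>
     (\<forall>m \<in> Poly_Mapping.keys f. (\<Sum>l \<in> Poly_Mapping.keys m. Poly_Mapping.lookup m l) = d)"

text \<open>
  The bracket of an arbitrary index sequence, extended from increasing sequences by antisymmetry;
  the exponent counts inversions.
\<close>

definition bracket_seq :: "nat list \<Rightarrow> bracket_poly" where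
  "bracket_seq js =
     (if distinct js
      then (-1) ^ card {(a, b). a < b \<and> b < length js \<and> js ! b < js ! a} * bracket (set js)
      else 0)"

text \<open>
  The quadratic relations
  \<open>\<Sum>\<^sub>t (-1)\<^sup>t [i\<^sub>1 \<dots> i\<^sub>r\<^sub>-\<^sub>1 j\<^sub>t] [j\<^sub>0 \<dots> j\<^sub>t\<^sub>-\<^sub>1 j\<^sub>t\<^sub>+\<^sub>1 \<dots> j\<^sub>r]\<close>.
\<close>

definition pluecker_relation :: "nat list \<Rightarrow> nat list \<Rightarrow> bracket_poly" where
  "pluecker_relation is js =
     (\<Sum>t<length js. (-1) ^ t * bracket_seq (is @ [js ! t]) *
                     bracket_seq (take t js @ drop (Suc t) js))"

definition pluecker_ideal :: "nat \<Rightarrow> nat \<Rightarrow> bracket_poly set" where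
  "pluecker_ideal r n = Idl\<^bsub>bracket_ring r n\<^esub>
     {pluecker_relation is js | is js. set is \<subseteq> {..<n} \<and> set js \<subseteq> {..<n} \<and>
        Suc (length is) = r \<and> length js = Suc r}"

definition coord_ring :: "nat \<Rightarrow> nat \<Rightarrow> bracket_poly set ring" where
  "coord_ring r n = bracket_ring r n Quot pluecker_ideal r n"

definition residue_class :: "nat \<Rightarrow> nat \<Rightarrow> bracket_poly \<Rightarrow> bracket_poly set" where
  "residue_class r n f = pluecker_ideal r n +>\<^bsub>bracket_ring r n\<^esub> f"

definition coord_piece :: "nat \<Rightarrow> nat \<Rightarrow> nat \<Rightarrow> bracket_poly set set" where
  "coord_piece r n d =
     residue_class r n ` {f \<in> carrier (bracket_ring r n). bracket_homogeneous d f}"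

text \<open>
  The function \<open>submatrix\<close> keeps the selected columns in increasing order.
\<close>

definition minor :: "complex mat \<Rightarrow> nat set \<Rightarrow> complex" where
  "minor A l = det (submatrix A UNIV l)"

definition bracket_eval :: "complex mat \<Rightarrow> bracket_poly \<Rightarrow> complex" where
  "bracket_eval A f =
     (\<Sum>m \<in> Poly_Mapping.keys f. Poly_Mapping.lookup f m *
        (\<Prod>l \<in> Poly_Mapping.keys m. minor A l ^ Poly_Mapping.lookup m l))"

text \<open>
  Quantifying over all basis matrices means vanishing at all nonzero points of the line over
  \<open>y\<close> in the affine cone, which is the right notion for inhomogeneous elements as well. All
  representatives of a residue class have the same value at a given matrix.
\<close>

definition vanishes_at :: "nat \<Rightarrow> nat \<Rightarrow> bracket_poly set \<Rightarrow> complex vec set \<Rightarrow> bool" where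
  "vanishes_at r n F y \<longleftrightarrow> (\<forall>A. basis_matrix r n y A \<longrightarrow> (\<forall>f \<in> F. bracket_eval A f = 0))"

section \<open>Matroid varieties\<close>

definition zariski_closed :: "nat \<Rightarrow> nat \<Rightarrow> complex vec set set \<Rightarrow> bool" where
  "zariski_closed r n Z \<longleftrightarrow>
     (\<exists>S \<subseteq> (\<Union>d. coord_piece r n d). Z = {y \<in> Gr r n. \<forall>F \<in> S. vanishes_at r n F y})"

definition zariski_closure :: "nat \<Rightarrow> nat \<Rightarrow> complex vec set set \<Rightarrow> complex vec set set" where
  "zariski_closure r n X = \<Inter>{Z. zariski_closed r n Z \<and> X \<subseteq> Z}"

definition matroid_variety :: "nat \<Rightarrow> nat \<Rightarrow> complex vec set \<Rightarrow> complex vec set set" where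
  "matroid_variety r n x =
     zariski_closure r n {y \<in> Gr r n. matroid_of r n y = matroid_of r n x}"

definition matroid_ideal :: "nat \<Rightarrow> nat \<Rightarrow> complex vec set \<Rightarrow> bracket_poly set set" where
  "matroid_ideal r n x =
     {F \<in> carrier (coord_ring r n). \<forall>y \<in> matroid_variety r n x. vanishes_at r n F y}"

definition nonbasis_ideal :: "nat \<Rightarrow> nat \<Rightarrow> complex vec set \<Rightarrow> bracket_poly set set" where
  "nonbasis_ideal r n x = Idl\<^bsub>coord_ring r n\<^esub>
     {residue_class r n (bracket l) | l. l \<in> bracket_indices r n \<and> l \<notin> snd (matroid_of r n x)}"

definition nontrivial :: "nat \<Rightarrow> nat \<Rightarrow> complex vec set \<Rightarrow> bracket_poly set \<Rightarrow> bool" where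
  "nontrivial r n x F \<longleftrightarrow> F \<in> matroid_ideal r n x \<and> F \<notin> nonbasis_ideal r n x"

section \<open>The projective plane\<close>

text \<open>
  Points and lines of the complex projective plane are the one- and two-dimensional subspaces of
  the space of triples.
\<close>

abbreviation proj_points :: "complex vec set set" where
  "proj_points \<equiv> Gr 1 3"

abbreviation proj_lines :: "complex vec set set" where
  "proj_lines \<equiv> Gr 2 3"

definition points_on :: "complex vec set \<Rightarrow> complex vec set set" where
  "points_on M = {p \<in> proj_points. p \<subseteq> M}"

definition proj_point :: "complex vec \<Rightarrow> complex vec set" where
  "proj_point v = LinearCombinations.module.span class_ring (cspace 3) {v}"

end

theory Submission
  imports Defs "Jordan_Normal_Form.DL_Rank"
begin

text \<open>
  The claim follows from Pascal's theorem. Write \<open>p\<^sub>i\<^sub>j\<close> for the common point of \<open>l\<^sub>i\<close> and \<open>m\<^sub>j\<close>;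
  these are \<open>k\<^sup>2\<close> distinct points, because their set has that many elements, and \<open>p\<^sub>i\<^sub>i = P\<^sub>i\<close>.
  The hexagon with vertices \<open>p\<^sub>1\<^sub>2\<close>, \<open>p\<^sub>1\<^sub>3\<close>, \<open>p\<^sub>2\<^sub>3\<close>, \<open>p\<^sub>2\<^sub>1\<close>, \<open>p\<^sub>3\<^sub>1\<close>, \<open>p\<^sub>3\<^sub>2\<close>
  has its sides on \<open>l\<^sub>1\<close>, \<open>m\<^sub>3\<close>, \<open>l\<^sub>2\<close>, \<open>m\<^sub>1\<close>, \<open>l\<^sub>3\<close>, \<open>m\<^sub>2\<close>, so its opposite sides meet in
  \<open>P\<^sub>1\<close>, \<open>P\<^sub>3\<close>, \<open>P\<^sub>2\<close>. These are collinear. The determinant of the three intersection points of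
  opposite sides, expanded in brackets of the vertices, is a polynomial of degree 4
  (\<open>pascal_poly\<close>, \<open>det3_meets\<close>); all incidences involved are recorded by the matroid, so it vanishes at
  every point with the same matroid and therefore on the matroid variety.

  The polynomial is nontrivial because the only collinearities are the given ones: no three vertices of
  the hexagon are collinear (\<open>hexagon_general_position\<close>), so every nonbasis bracket contains a column
  outside the hexagon. All of these brackets vanish at a matrix whose columns outside the hexagon are
  zero, and the six remaining columns can be chosen such that the Pascal polynomial does not vanish
  (\<open>pascal_witness\<close>). Such a matrix may be used although its columns do not realize the matroid,
  since bracket polynomials modulo the Pluecker relations can be evaluated at any matrix
  (\<open>bracket_eval_nonbasis_ideal\<close>).

  Multiplying by a power of a bracket that is nonzero at this matrix keeps both properties. This gives
  nontrivial elements in every degree from 4 on, and \<open>(k + 1) choose 3 \<ge> 4\<close>.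
\<close>

section \<open>Evaluation of bracket polynomials\<close>

definition monomial_degree :: "(nat set \<Rightarrow>\<^sub>0 nat) \<Rightarrow> nat" where
  "monomial_degree m = (\<Sum>l\<in>Poly_Mapping.keys m. Poly_Mapping.lookup m l)"

definition monomial_eval :: "complex mat \<Rightarrow> (nat set \<Rightarrow>\<^sub>0 nat) \<Rightarrow> complex" where
  "monomial_eval A m = (\<Prod>l\<in>Poly_Mapping.keys m. minor A l ^ Poly_Mapping.lookup m l)"

lemma monomial_degree_add: "monomial_degree (m + m') = monomial_degree m + monomial_degree m'"
  unfolding monomial_degree_def by (rule setsum_keys_plus_distrib) simp_all

lemma monomial_eval_superset:
  assumes "finite S" "Poly_Mapping.keys m \<subseteq> S"
  shows "monomial_eval A m = (\<Prod>l\<in>S. minor A l ^ Poly_Mapping.lookup m l)"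
  unfolding monomial_eval_def
  by (rule prod.mono_neutral_left) (use assms in \<open>auto simp: in_keys_iff\<close>)

lemma monomial_eval_add: "monomial_eval A (m + m') = monomial_eval A m * monomial_eval A m'"
proof -
  let ?S = "Poly_Mapping.keys m \<union> Poly_Mapping.keys m'"
  have "monomial_eval A (m + m') = (\<Prod>l\<in>?S. minor A l ^ Poly_Mapping.lookup (m + m') l)"
    by (rule monomial_eval_superset) (simp_all add: keys_add)
  also have "\<dots> = monomial_eval A m * monomial_eval A m'"
    by (simp add: monomial_eval_superset[of ?S] lookup_add power_add prod.distrib)
  finally show ?thesis .
qed

lemma bracket_eval_eq:
  "bracket_eval A f = (\<Sum>m\<in>Poly_Mapping.keys f. Poly_Mapping.lookup f m * monomial_eval A m)"
  unfolding bracket_eval_def monomial_eval_def ..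

lemma bracket_eval_zero [simp]: "bracket_eval A 0 = 0"
  by (simp add: bracket_eval_eq)

lemma bracket_eval_single: "bracket_eval A (Poly_Mapping.single m c) = c * monomial_eval A m"
  by (simp add: bracket_eval_eq)

lemma bracket_eval_one [simp]: "bracket_eval A 1 = 1"
  by (simp add: bracket_eval_eq monomial_eval_def)

lemma bracket_eval_bracket [simp]: "bracket_eval A (bracket l) = minor A l"
  by (simp add: bracket_def bracket_eval_single monomial_eval_def)

lemma bracket_eval_add [simp]: "bracket_eval A (f + g) = bracket_eval A f + bracket_eval A g"
  unfolding bracket_eval_eq
  by (rule setsum_keys_plus_distrib) (simp_all add: algebra_simps)

lemma bracket_eval_uminus [simp]: "bracket_eval A (- f) = - bracket_eval A f"
  by (metis add.right_inverse bracket_eval_add bracket_eval_zero minus_unique)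

lemma bracket_eval_diff [simp]: "bracket_eval A (f - g) = bracket_eval A f - bracket_eval A g"
  by (metis add_uminus_conv_diff bracket_eval_add bracket_eval_uminus)

text \<open>
  Induction by adding monomials, with no condition on the support, so that a single monomial can
  be split off both factors of a product.
\<close>

lemma poly_mapping_single_add_induct [case_names zero add]:
  fixes f :: "'a \<Rightarrow>\<^sub>0 'b::monoid_add"
  assumes "P 0" and "\<And>m c f. P f \<Longrightarrow> P (Poly_Mapping.single m c + f)"
  shows "P f"
proof (induction f rule: update_induct)
  case (update f a b)
  have "Poly_Mapping.update a b f = Poly_Mapping.single a b + f"
    using update(1)
    by (intro poly_mapping_eqI) (auto simp: lookup_update lookup_add lookup_single when_def in_keys_iff)
  with assms(2) update show ?case by simp
qed (fact assms(1))

lemma bracket_eval_mult [simp]: "bracket_eval A (f * g) = bracket_eval A f * bracket_eval A g"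
proof (induction f rule: poly_mapping_single_add_induct)
  case (add m c f)
  have "bracket_eval A (Poly_Mapping.single m c * g) = c * monomial_eval A m * bracket_eval A g"
    by (induction g rule: poly_mapping_single_add_induct)
       (simp_all add: algebra_simps mult_single bracket_eval_single monomial_eval_add)
  with add show ?case
    by (simp add: algebra_simps bracket_eval_single)
qed simp

lemma bracket_eval_power [simp]: "bracket_eval A (f ^ n) = bracket_eval A f ^ n"
  by (induction n) simp_all

abbreviation poly_carrier where "poly_carrier r n \<equiv> carrier (bracket_ring r n)"

lemma bracket_ring_simps [simp]:
  "f \<otimes>\<^bsub>bracket_ring r n\<^esub> g = f * g" "f \<oplus>\<^bsub>bracket_ring r n\<^esub> g = f + g"
  "\<one>\<^bsub>bracket_ring r n\<^esub> = 1" "\<zero>\<^bsub>bracket_ring r n\<^esub> = 0"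
  by (simp_all add: bracket_ring_def)

lemma poly_carrier_add: "f \<in> poly_carrier r n \<Longrightarrow> g \<in> poly_carrier r n \<Longrightarrow> f + g \<in> poly_carrier r n"
  using keys_add[of f g] by (fastforce simp: bracket_ring_def)

lemma poly_carrier_mult:
  assumes "f \<in> poly_carrier r n" "g \<in> poly_carrier r n"
  shows "f * g \<in> poly_carrier r n"
proof -
  have "Poly_Mapping.keys m \<subseteq> bracket_indices r n" if m: "m \<in> Poly_Mapping.keys (f * g)" for m
  proof -
    obtain a b where "m = a + b" "a \<in> Poly_Mapping.keys f" "b \<in> Poly_Mapping.keys g"
      using m keys_mult[of f g] by blast
    then show ?thesis
      using assms keys_add[of a b] by (fastforce simp: bracket_ring_def)
  qed
  then show ?thesis by (simp add: bracket_ring_def)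
qed

lemma poly_carrier_zero: "0 \<in> poly_carrier r n" and poly_carrier_one: "1 \<in> poly_carrier r n"
  and poly_carrier_uminus: "f \<in> poly_carrier r n \<Longrightarrow> - f \<in> poly_carrier r n"
  by (simp_all add: bracket_ring_def in_keys_iff)

lemma poly_carrier_diff: "f \<in> poly_carrier r n \<Longrightarrow> g \<in> poly_carrier r n \<Longrightarrow> f - g \<in> poly_carrier r n"
  using poly_carrier_add[of f r n "- g"] poly_carrier_uminus by simp

lemma poly_carrier_power: "f \<in> poly_carrier r n \<Longrightarrow> f ^ d \<in> poly_carrier r n"
  by (induction d) (simp_all add: poly_carrier_one poly_carrier_mult)

lemma poly_carrier_sum: "(\<And>x. x \<in> S \<Longrightarrow> f x \<in> poly_carrier r n) \<Longrightarrow> sum f S \<in> poly_carrier r n"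
  by (induction S rule: infinite_finite_induct) (simp_all add: poly_carrier_zero poly_carrier_add)

lemma bracket_in_carrier: "l \<in> bracket_indices r n \<Longrightarrow> bracket l \<in> poly_carrier r n"
  by (simp add: bracket_ring_def bracket_def)

lemmas poly_carrier_closed = poly_carrier_zero poly_carrier_one poly_carrier_add
  poly_carrier_uminus poly_carrier_diff poly_carrier_mult poly_carrier_power bracket_in_carrier

lemma cring_bracket_ring: "cring (bracket_ring r n)"
proof (rule cringI)
  show "abelian_group (bracket_ring r n)"
  proof (rule abelian_groupI)
    show "\<exists>g\<in>poly_carrier r n. g \<oplus>\<^bsub>bracket_ring r n\<^esub> f = \<zero>\<^bsub>bracket_ring r n\<^esub>"
      if "f \<in> poly_carrier r n" for f
      using that by (intro bexI[of _ "- f"]) (simp_all add: poly_carrier_uminus)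
  qed (simp_all add: poly_carrier_closed add.assoc add.commute)
  show "Group.comm_monoid (bracket_ring r n)"
    by (rule comm_monoidI) (simp_all add: poly_carrier_closed mult.assoc mult.commute)
qed (simp add: distrib_right)

lemma ring_bracket_ring: "ring (bracket_ring r n)"
  by (rule cring.axioms(1)[OF cring_bracket_ring])

lemma a_inv_bracket_ring:
  assumes "f \<in> poly_carrier r n"
  shows "\<ominus>\<^bsub>bracket_ring r n\<^esub> f = - f"
proof -
  interpret R: ring "bracket_ring r n" by (rule ring_bracket_ring)
  show ?thesis
    by (rule R.minus_equality) (simp_all add: assms poly_carrier_uminus)
qed

lemma bracket_homogeneous_eq:
  "bracket_homogeneous d f \<longleftrightarrow> (\<forall>m\<in>Poly_Mapping.keys f. monomial_degree m = d)"
  by (simp add: bracket_homogeneous_def monomial_degree_def)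

lemma bracket_homogeneous_add:
  "bracket_homogeneous d f \<Longrightarrow> bracket_homogeneous d g \<Longrightarrow> bracket_homogeneous d (f + g)"
  using keys_add[of f g] by (fastforce simp: bracket_homogeneous_eq)

lemma bracket_homogeneous_uminus: "bracket_homogeneous d f \<Longrightarrow> bracket_homogeneous d (- f)"
  by (simp add: bracket_homogeneous_eq in_keys_iff)

lemma bracket_homogeneous_diff:
  "bracket_homogeneous d f \<Longrightarrow> bracket_homogeneous d g \<Longrightarrow> bracket_homogeneous d (f - g)"
  using bracket_homogeneous_add[of d f "- g"] bracket_homogeneous_uminus by simp

lemma bracket_homogeneous_mult:
  assumes "bracket_homogeneous d f" "bracket_homogeneous e g"
  shows "bracket_homogeneous (d + e) (f * g)"
  unfolding bracket_homogeneous_eq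
proof
  fix m assume "m \<in> Poly_Mapping.keys (f * g)"
  then obtain a b where "m = a + b" "a \<in> Poly_Mapping.keys f" "b \<in> Poly_Mapping.keys g"
    using keys_mult[of f g] by blast
  with assms show "monomial_degree m = d + e"
    by (simp add: bracket_homogeneous_eq monomial_degree_add)
qed

lemma bracket_homogeneous_one: "bracket_homogeneous 0 1"
  by (simp add: bracket_homogeneous_def)

lemma bracket_homogeneous_power: "bracket_homogeneous d f \<Longrightarrow> bracket_homogeneous (d * n) (f ^ n)"
  by (induction n) (simp_all add: bracket_homogeneous_one bracket_homogeneous_mult)

lemma bracket_homogeneous_bracket: "bracket_homogeneous 1 (bracket l)"
  by (simp add: bracket_homogeneous_def bracket_def)

section \<open>Brackets of three columns and the Pluecker relations\<close>

definition det3 :: "complex vec \<Rightarrow> complex vec \<Rightarrow> complex vec \<Rightarrow> complex" where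
  "det3 u v w = u $ 0 * (v $ 1 * w $ 2 - v $ 2 * w $ 1)
              - u $ 1 * (v $ 0 * w $ 2 - v $ 2 * w $ 0)
              + u $ 2 * (v $ 0 * w $ 1 - v $ 1 * w $ 0)"

lemma det_2:
  assumes "M \<in> carrier_mat 2 2"
  shows "det M = M $$ (0,0) * M $$ (1,1) - M $$ (0,1) * M $$ (1,0)"
  using laplace_expansion_row[OF assms, of 0] assms
  by (simp add: numeral_2_eq_2 cofactor_def mat_delete_def det_single)

lemma det_3:
  assumes "M \<in> carrier_mat 3 3"
  shows "det M = det3 (col M 0) (col M 1) (col M 2)"
proof -
  have "det M = (\<Sum>j<3. M $$ (0, j) * cofactor M 0 j)"
    using laplace_expansion_row[OF assms, of 0] by simp
  also have "\<dots> = M $$ (0,0) * (M $$ (1,1) * M $$ (2,2) - M $$ (1,2) * M $$ (2,1))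
              - M $$ (0,1) * (M $$ (1,0) * M $$ (2,2) - M $$ (1,2) * M $$ (2,0))
              + M $$ (0,2) * (M $$ (1,0) * M $$ (2,1) - M $$ (1,1) * M $$ (2,0))"
    using assms
    by (simp add: eval_nat_numeral lessThan_Suc cofactor_def mat_delete_def det_2[simplified eval_nat_numeral]
        algebra_simps)
  also have "\<dots> = det3 (col M 0) (col M 1) (col M 2)"
    using assms by (simp add: det3_def algebra_simps)
  finally show ?thesis .
qed

text \<open>
  \<open>pick l\<close> lists an index set \<open>l\<close> in increasing order, so it turns sums over \<open>l\<close> into sums over
  the columns of the minor.
\<close>

lemma bij_betw_pick:
  assumes "l \<in> bracket_indices r n"
  shows "bij_betw (pick l) {..<r} l"
proof -
  have l: "finite l" "card l = r" using assms by (auto simp: bracket_indices_def finite_subset)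
  have "inj_on (pick l) {..<r}"
    using pick_mono_le[of _ l] l by (intro linorder_inj_onI') (fastforce simp: nat_neq_iff)
  moreover have "pick l ` {..<r} \<subseteq> l"
    using pick_in_set_le[of _ l] l by auto
  ultimately show ?thesis
    using l by (simp add: bij_betw_def card_image card_subset_eq)
qed

lemma submatrix_cols:
  assumes "A \<in> carrier_mat r n" "l \<in> bracket_indices r n"
  shows "submatrix A UNIV l \<in> carrier_mat r r"
    and "i < r \<Longrightarrow> t < r \<Longrightarrow> submatrix A UNIV l $$ (i, t) = A $$ (i, pick l t)"
proof -
  have c: "card {j. j < dim_col A \<and> j \<in> l} = r"
  proof -
    have "{j. j < dim_col A \<and> j \<in> l} = l" using assms by (auto simp: bracket_indices_def)
    then show ?thesis using assms by (simp add: bracket_indices_def)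
  qed
  show "submatrix A UNIV l \<in> carrier_mat r r"
    unfolding carrier_mat_def dim_submatrix mem_Collect_eq c using assms by simp
  show "submatrix A UNIV l $$ (i, t) = A $$ (i, pick l t)" if "i < r" "t < r"
    using submatrix_index[of i A UNIV t l] that assms unfolding c pick_UNIV by simp
qed

lemma minor_3_eq_det3:
  assumes Y: "Y \<in> carrier_mat 3 n" and xyz: "x < y" "y < z" "z < n"
  shows "minor Y {x, y, z} = det3 (col Y x) (col Y y) (col Y z)"
proof -
  let ?l = "{x, y, z}"
  have "?l \<in> bracket_indices 3 n"
    using xyz by (simp add: bracket_indices_def)
  note M = submatrix_cols[OF Y this]
  have below: "{a \<in> ?l. a < x} = {}" "{a \<in> ?l. a < y} = {x}" "{a \<in> ?l. a < z} = {x, y}"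
    using xyz by auto
  have cards: "card ({} :: nat set) = 0" "card {x} = 1" "card {x, y} = 2"
    using xyz by simp_all
  have "pick ?l (card {a \<in> ?l. a < x}) = x" "pick ?l (card {a \<in> ?l. a < y}) = y"
    "pick ?l (card {a \<in> ?l. a < z}) = z"
    by (rule pick_card_in_set; blast)+
  then have p: "pick ?l 0 = x" "pick ?l 1 = y" "pick ?l 2 = z"
    unfolding below cards by (simp_all only:)
  have entry: "col (submatrix Y UNIV ?l) j $ i = col Y (pick ?l j) $ i"
    if "i < 3" "j < 3" "pick ?l j < n" for i j
    using M(2)[OF that(1,2)] M(1) Y that by simp
  have "col (submatrix Y UNIV ?l) 0 $ i = col Y x $ i \<and> col (submatrix Y UNIV ?l) 1 $ i = col Y y $ i \<and>
        col (submatrix Y UNIV ?l) 2 $ i = col Y z $ i" if "i < 3" for i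
    using entry[OF that, of 0] entry[OF that, of 1] entry[OF that, of 2] xyz unfolding p by simp
  then show ?thesis
    unfolding minor_def det_3[OF M(1)] det3_def by simp
qed

lemma bracket_seq_3:
  "bracket_seq [x, y, z] =
     (if distinct [x, y, z]
      then (-1) ^ ((if y < x then 1 else 0) + (if z < x then 1 else 0) + (if z < y then 1 else 0)) *
           bracket {x, y, z} else 0)"
proof -
  let ?js = "[x, y, z]"
  have "{(a, b). a < b \<and> b < length ?js \<and> ?js ! b < ?js ! a} =
     (if y < x then {(0, 1)} else {}) \<union> (if z < x then {(0, 2)} else {}) \<union>
     (if z < y then {(1, 2 :: nat)} else {})"
    by (auto simp: less_Suc_eq numeral_2_eq_2)
  then have "card {(a, b). a < b \<and> b < length ?js \<and> ?js ! b < ?js ! a} =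
     (if y < x then 1 else 0) + (if z < x then 1 else 0) + (if z < y then 1 else 0)"
    by (simp add: card_insert_if)
  then show ?thesis unfolding bracket_seq_def by simp
qed

text \<open>
  Both sides are alternating in the three indices: the inversion count in a bracket of a sequence
  is the sign of the permutation that sorts it.
\<close>

lemma bracket_eval_bracket_seq:
  assumes Y: "Y \<in> carrier_mat 3 n" and "x < n" "y < n" "z < n"
  shows "bracket_eval Y (bracket_seq [x, y, z]) = det3 (col Y x) (col Y y) (col Y z)"
proof (cases "distinct [x, y, z]")
  case False
  then show ?thesis by (auto simp: bracket_seq_def det3_def algebra_simps)
next
  case True
  then consider "x < y" "y < z" | "x < z" "z < y" | "y < x" "x < z" | "y < z" "z < x"
    | "z < x" "x < y" | "z < y" "y < x"
    by (simp only: distinct.simps list.set) (metis insertCI nat_neq_iff)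
  moreover have perm: "{x, z, y} = {x, y, z}" "{y, x, z} = {x, y, z}" "{y, z, x} = {x, y, z}"
    "{z, x, y} = {x, y, z}" "{z, y, x} = {x, y, z}"
    by auto
  ultimately show ?thesis
  proof cases
    case 1 show ?thesis
      using 1 minor_3_eq_det3[OF Y, of x y z] assms True
      by (simp add: bracket_seq_3)
  next
    case 2 show ?thesis
      using 2 minor_3_eq_det3[OF Y, of x z y] assms True
      by (simp add: bracket_seq_3 perm) (simp add: det3_def algebra_simps)
  next
    case 3 show ?thesis
      using 3 minor_3_eq_det3[OF Y, of y x z] assms True
      by (simp add: bracket_seq_3 perm) (simp add: det3_def algebra_simps)
  next
    case 4 show ?thesis
      using 4 minor_3_eq_det3[OF Y, of y z x] assms True
      by (simp add: bracket_seq_3 perm) (simp add: det3_def algebra_simps)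
  next
    case 5 show ?thesis
      using 5 minor_3_eq_det3[OF Y, of z x y] assms True
      by (simp add: bracket_seq_3 perm) (simp add: det3_def algebra_simps)
  next
    case 6 show ?thesis
      using 6 minor_3_eq_det3[OF Y, of z y x] assms True
      by (simp add: bracket_seq_3 perm) (simp add: det3_def algebra_simps)
  qed
qed

text \<open>
  Four vectors \<open>v\<^sub>0, \<dots>, v\<^sub>3\<close> of a three-dimensional space satisfy the linear relation whose coefficients
  are the signed determinants of the other three (Cramer's rule); applying \<open>det3 u u'\<close> to it gives the
  identity. It holds for every matrix, of full rank or not.
\<close>

lemma bracket_eval_pluecker_relation:
  assumes Y: "Y \<in> carrier_mat 3 n"
    and "set is \<subseteq> {..<n}" "set js \<subseteq> {..<n}" "Suc (length is) = 3" "length js = 4"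
  shows "bracket_eval Y (pluecker_relation is js) = 0"
proof -
  obtain p q where "is": "is = [p, q]"
    using assms(4) by (auto simp: length_Suc_conv eval_nat_numeral)
  obtain a b c d where js: "js = [a, b, c, d]"
    using assms(5) by (auto simp: length_Suc_conv eval_nat_numeral)
  have "p < n" "q < n" "a < n" "b < n" "c < n" "d < n"
    using assms(2,3) "is" js by auto
  then have "bracket_eval Y (pluecker_relation is js) =
      det3 (col Y p) (col Y q) (col Y a) * det3 (col Y b) (col Y c) (col Y d)
    - det3 (col Y p) (col Y q) (col Y b) * det3 (col Y a) (col Y c) (col Y d)
    + det3 (col Y p) (col Y q) (col Y c) * det3 (col Y a) (col Y b) (col Y d)
    - det3 (col Y p) (col Y q) (col Y d) * det3 (col Y a) (col Y b) (col Y c)"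
    unfolding pluecker_relation_def "is" js
    by (simp add: lessThan_Suc bracket_eval_bracket_seq[OF Y])
  also have "\<dots> = 0"
    unfolding det3_def by (simp add: algebra_simps)
  finally show ?thesis .
qed

section \<open>Evaluation on the coordinate ring\<close>

lemma bracket_seq_in_carrier:
  assumes "set js \<subseteq> {..<n}" "length js = r"
  shows "bracket_seq js \<in> poly_carrier r n"
  using assms unfolding bracket_seq_def
  by (auto intro!: poly_carrier_closed simp: bracket_indices_def distinct_card)

lemma pluecker_relation_in_carrier:
  assumes "set is \<subseteq> {..<n}" "set js \<subseteq> {..<n}" "Suc (length is) = r" "length js = Suc r"
  shows "pluecker_relation is js \<in> poly_carrier r n"
  unfolding pluecker_relation_def
proof (intro poly_carrier_sum poly_carrier_mult poly_carrier_power bracket_seq_in_carrier)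
  fix t assume t: "t \<in> {..<length js}"
  show "set (is @ [js ! t]) \<subseteq> {..<n}" "length (is @ [js ! t]) = r"
    using assms t nth_mem[of t js] by (simp_all add: subset_iff)
  show "set (take t js @ drop (Suc t) js) \<subseteq> {..<n}"
    using assms set_take_subset[of t js] set_drop_subset[of "Suc t" js] by auto
  show "length (take t js @ drop (Suc t) js) = r"
    using assms t by auto
qed (simp add: poly_carrier_uminus poly_carrier_one)

lemma ideal_pluecker: "ideal (pluecker_ideal r n) (bracket_ring r n)"
  unfolding pluecker_ideal_def
  by (rule ring.genideal_ideal[OF ring_bracket_ring]) (auto intro: pluecker_relation_in_carrier)

text \<open>
  Since the Pluecker relations hold for the minors of every matrix, each \<open>3 \<times> n\<close> matrix, even one
  of rank below 3, has an evaluation map on the coordinate ring: the Pluecker ideal lies in the kernel.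
\<close>

definition eval_kernel :: "nat \<Rightarrow> nat \<Rightarrow> complex mat \<Rightarrow> bracket_poly set" where
  "eval_kernel r n Y = {f \<in> poly_carrier r n. bracket_eval Y f = 0}"

lemma ideal_eval_kernel: "ideal (eval_kernel r n Y) (bracket_ring r n)"
proof (rule idealI[OF ring_bracket_ring])
  interpret R: ring "bracket_ring r n" by (rule ring_bracket_ring)
  show "subgroup (eval_kernel r n Y) (add_monoid (bracket_ring r n))"
    by (rule R.add.subgroupI)
       (auto simp: eval_kernel_def a_inv_def[symmetric] a_inv_bracket_ring poly_carrier_closed
             intro: exI[of _ 0])
qed (auto simp: eval_kernel_def poly_carrier_closed)

lemma pluecker_ideal_subset_eval_kernel:
  assumes "Y \<in> carrier_mat 3 n"
  shows "pluecker_ideal 3 n \<subseteq> eval_kernel 3 n Y"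
  unfolding pluecker_ideal_def
  by (rule ring.genideal_minimal[OF ring_bracket_ring ideal_eval_kernel])
     (auto simp: eval_kernel_def bracket_eval_pluecker_relation[OF assms] pluecker_relation_in_carrier)

lemma bracket_eval_residue_class:
  assumes Y: "Y \<in> carrier_mat 3 n" and g: "g \<in> residue_class 3 n f"
  shows "bracket_eval Y g = bracket_eval Y f"
proof -
  obtain h where "h \<in> pluecker_ideal 3 n" "g = h + f"
    using g by (auto simp: residue_class_def a_r_coset_def')
  then show ?thesis
    using pluecker_ideal_subset_eval_kernel[OF Y] by (auto simp: eval_kernel_def)
qed

lemma residue_class_self:
  assumes "f \<in> poly_carrier r n" shows "f \<in> residue_class r n f"
  unfolding residue_class_def
  by (rule abelian_subgroup.a_rcos_self[OF _ assms])
     (simp add: abelian_subgroupI3 ideal.axioms(1)[OF ideal_pluecker] ring.is_abelian_group[OF ring_bracket_ring])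

lemma residue_class_in_coord_ring:
  "f \<in> poly_carrier r n \<Longrightarrow> residue_class r n f \<in> carrier (coord_ring r n)"
  unfolding residue_class_def coord_ring_def FactRing_def A_RCOSETS_def'
  by auto

text \<open>
  This is how an element is kept out of the ideal generated by the nonbases: it suffices to find one
  matrix at which all nonbasis brackets vanish while the element does not. The matrix need not
  represent the matroid, and some of its columns may be zero.
\<close>

lemma bracket_eval_nonbasis_ideal:
  assumes Y: "Y \<in> carrier_mat 3 n"
    and minors: "\<And>l. l \<in> bracket_indices 3 n \<Longrightarrow> l \<notin> snd (matroid_of 3 n x) \<Longrightarrow> minor Y l = 0"
    and f: "f \<in> poly_carrier 3 n" and F: "residue_class 3 n f \<in> nonbasis_ideal 3 n x"
  shows "bracket_eval Y f = 0"
proof -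
  let ?J = "residue_class 3 n ` eval_kernel 3 n Y"
  have "ideal ?J (coord_ring 3 n)"
    unfolding residue_class_def[abs_def] coord_ring_def
    by (rule ring.ring_ideal_imp_quot_ideal[OF ring_bracket_ring ideal_pluecker ideal_eval_kernel])
  moreover have "{residue_class 3 n (bracket l) |l.
      l \<in> bracket_indices 3 n \<and> l \<notin> snd (matroid_of 3 n x)} \<subseteq> ?J"
    using minors by (auto simp: eval_kernel_def bracket_in_carrier)
  moreover have "ring (coord_ring 3 n)"
    unfolding coord_ring_def by (rule ideal.quotient_is_ring[OF ideal_pluecker])
  ultimately have "nonbasis_ideal 3 n x \<subseteq> ?J"
    unfolding nonbasis_ideal_def by (intro ring.genideal_minimal)
  with F obtain g where "g \<in> eval_kernel 3 n Y" "residue_class 3 n f = residue_class 3 n g"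
    by blast
  then show ?thesis
    using bracket_eval_residue_class[OF Y, of f g] residue_class_self[OF f]
    by (simp add: eval_kernel_def)
qed

section \<open>The matroid of a row space\<close>

text \<open>
  A minor vanishes exactly if its columns have a linear relation. Written as a vector supported on
  the index set, such a relation is orthogonal to all rows, hence to the row space; so the vanishing of
  minors, and with it the matroid, depends on the row space only.
\<close>

lemma minor_eq_0_iff_relation:
  assumes A: "A \<in> carrier_mat r n" and l: "l \<in> bracket_indices r n"
  shows "minor A l = 0 \<longleftrightarrow>
    (\<exists>c\<in>carrier_vec n. c \<noteq> 0\<^sub>v n \<and> (\<forall>j<n. j \<notin> l \<longrightarrow> c $ j = 0) \<and> A *\<^sub>v c = 0\<^sub>v r)"
    (is "_ \<longleftrightarrow> ?R")
proof -
  let ?M = "submatrix A UNIV l"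
  note M = submatrix_cols[OF A l]
  note bij = bij_betw_pick[OF l]
  have ln: "l \<subseteq> {..<n}" using l by (simp add: bracket_indices_def)
  have pick: "pick l t \<in> l" "pick l t < n" if "t < r" for t
    using bij_betwE[OF bij] that ln by auto
  have prod: "A *\<^sub>v c = ?M *\<^sub>v v"
    if c: "c \<in> carrier_vec n" "\<forall>j<n. j \<notin> l \<longrightarrow> c $ j = 0" and v: "v \<in> carrier_vec r"
      "\<And>t. t < r \<Longrightarrow> v $ t = c $ (pick l t)" for c v
  proof (rule eq_vecI)
    fix i assume "i < dim_vec (?M *\<^sub>v v)"
    then have i: "i < r" using M(1) by simp
    have "(A *\<^sub>v c) $ i = (\<Sum>j<n. A $$ (i, j) * c $ j)"
      using A i c by (simp add: scalar_prod_def lessThan_atLeast0)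
    also have "\<dots> = (\<Sum>j\<in>l. A $$ (i, j) * c $ j)"
      using ln c(2) by (intro sum.mono_neutral_right) auto
    also have "\<dots> = (\<Sum>t<r. A $$ (i, pick l t) * c $ pick l t)"
      by (rule sum.reindex_bij_betw[OF bij, symmetric])
    also have "\<dots> = (\<Sum>t<r. ?M $$ (i, t) * v $ t)"
      using M(2)[OF i] v(2) by simp
    also have "\<dots> = (?M *\<^sub>v v) $ i"
      using M(1) i v(1) by (simp add: scalar_prod_def lessThan_atLeast0)
    finally show "(A *\<^sub>v c) $ i = (?M *\<^sub>v v) $ i" .
  qed (use A M in simp)
  show ?thesis
  proof
    assume "minor A l = 0"
    then obtain v where v: "v \<in> carrier_vec r" "v \<noteq> 0\<^sub>v r" "?M *\<^sub>v v = 0\<^sub>v r"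
      unfolding minor_def det_0_iff_vec_prod_zero[OF M(1)] by blast
    define c where "c = vec n (\<lambda>j. if j \<in> l then v $ (the_inv_into {..<r} (pick l) j) else 0)"
    have cp: "c $ pick l t = v $ t" if "t < r" for t
      using that pick[OF that] bij by (simp add: c_def bij_betw_def the_inv_into_f_f)
    obtain t where "t < r" "v $ t \<noteq> 0"
      using v(1,2) by (metis carrier_vecD eq_vecI index_zero_vec)
    then have "c \<noteq> 0\<^sub>v n" using cp pick by (metis index_zero_vec(1))
    moreover have "A *\<^sub>v c = 0\<^sub>v r"
      using prod[of c v] v cp by (simp add: c_def)
    ultimately show ?R
      by (intro bexI[of _ c]) (auto simp: c_def)
  next
    assume ?R
    then obtain c where c: "c \<in> carrier_vec n" "c \<noteq> 0\<^sub>v n" "\<forall>j<n. j \<notin> l \<longrightarrow> c $ j = 0"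
      "A *\<^sub>v c = 0\<^sub>v r" by blast
    define v where "v = vec r (\<lambda>t. c $ pick l t)"
    obtain j where j: "j < n" "c $ j \<noteq> 0"
      using c(1,2) by (metis carrier_vecD eq_vecI index_zero_vec)
    then have "j \<in> pick l ` {..<r}"
      using c(3) bij by (auto simp: bij_betw_def)
    then obtain t where "t < r" "v $ t \<noteq> 0"
      using j by (auto simp: v_def)
    then have "v \<noteq> 0\<^sub>v r" by auto
    moreover have "?M *\<^sub>v v = 0\<^sub>v r"
      using prod[of c v] c by (simp add: v_def)
    ultimately show "minor A l = 0"
      unfolding minor_def det_0_iff_vec_prod_zero[OF M(1)] by (intro exI[of _ v]) (simp add: v_def)
  qed
qed

lemma mult_mat_vec_eq_0_iff_orthogonal:
  fixes A :: "'a::comm_ring_1 mat"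
  assumes A: "A \<in> carrier_mat r n" and c: "c \<in> carrier_vec n"
  shows "A *\<^sub>v c = 0\<^sub>v r \<longleftrightarrow> c \<in> vec_module.orthogonal_complement n (set (rows A))"
proof -
  have "A *\<^sub>v c = 0\<^sub>v r \<longleftrightarrow> (\<forall>i<r. row A i \<bullet> c = 0)"
    using A by (auto simp: vec_eq_iff)
  also have "\<dots> \<longleftrightarrow> (\<forall>w\<in>set (rows A). c \<bullet> w = 0)"
  proof -
    have "row A i \<bullet> c = c \<bullet> row A i" if "i < r" for i
      using comm_scalar_prod[of "row A i" n c] A c that by auto
    then show ?thesis using A by (auto simp: rows_def)
  qed
  finally show ?thesis using c by (simp add: vec_module.orthogonal_complement_def)
qed

lemma minor_eq_0_cong_span:
  assumes A: "A \<in> carrier_mat r n" and B: "B \<in> carrier_mat r n" and l: "l \<in> bracket_indices r n"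
    and span: "LinearCombinations.module.span class_ring (cspace n) (set (rows A)) =
               LinearCombinations.module.span class_ring (cspace n) (set (rows B))"
  shows "minor A l = 0 \<longleftrightarrow> minor B l = 0"
proof -
  interpret vec_space "TYPE(complex)" n .
  have "set (rows A) \<subseteq> carrier_vec n" "set (rows B) \<subseteq> carrier_vec n"
    using A B by (auto simp: rows_def)
  then have "orthogonal_complement (set (rows A)) = orthogonal_complement (set (rows B))"
    using in_orthogonal_complement_span span by metis
  then show ?thesis
    unfolding minor_eq_0_iff_relation[OF A l] minor_eq_0_iff_relation[OF B l]
    using mult_mat_vec_eq_0_iff_orthogonal[OF A] mult_mat_vec_eq_0_iff_orthogonal[OF B]
    by metis
qed

lemma column_matroid_bases:
  assumes A: "A \<in> carrier_mat r n"
  shows "snd (column_matroid A) = {l \<in> bracket_indices r n. minor A l \<noteq> 0}"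
proof -
  interpret vec_space "TYPE(complex)" r .
  have "inj_on (col A) l \<and> \<not> lin_dep (col A ` l) \<longleftrightarrow> minor A l \<noteq> 0"
    if l: "l \<in> bracket_indices r n" for l
  proof -
    let ?M = "submatrix A UNIV l"
    note M = submatrix_cols[OF A l]
    note bij = bij_betw_pick[OF l]
    have "pick l t < n" if "t < r" for t
      using bij_betwE[OF bij] that l by (auto simp: bracket_indices_def)
    then have "col ?M t = col A (pick l t)" if "t < r" for t
      using M A that by (intro eq_vecI) auto
    then have cols: "cols ?M = map (\<lambda>t. col A (pick l t)) [0..<r]"
      using M(1) by (simp add: cols_def)
    have set: "set (cols ?M) = col A ` l"
      using bij unfolding cols by (auto simp: bij_betw_def lessThan_atLeast0 image_image[symmetric])
    have "distinct (cols ?M) \<longleftrightarrow> inj_on (col A \<circ> pick l) {..<r}"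
      unfolding cols by (simp add: distinct_map comp_def lessThan_atLeast0)
    also have "\<dots> \<longleftrightarrow> inj_on (col A) l"
      using bij by (metis bij_betw_def comp_inj_on_iff)
    finally have dist: "distinct (cols ?M) \<longleftrightarrow> inj_on (col A) l" .
    have "minor A l \<noteq> 0 \<longleftrightarrow> rank ?M = r"
      unfolding minor_def by (rule det_rank_iff[OF M(1)])
    also have "\<dots> \<longleftrightarrow> distinct (cols ?M) \<and> \<not> lin_dep (set (cols ?M))"
      using lin_indpt_full_rank[OF M(1)] full_rank_lin_indpt[OF M(1)] non_distinct_low_rank[OF M(1)]
      by (metis less_irrefl)
    finally show ?thesis unfolding dist set by simp
  qed
  then show ?thesis
    using A by (auto simp: column_matroid_def bracket_indices_def)
qed

text \<open>
  A relation between the rows, or a repetition among them, would pass to the rows of every maximal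
  square submatrix.
\<close>

lemma basis_matrix_row_space:
  assumes A: "A \<in> carrier_mat r n" and l: "l \<in> bracket_indices r n" and nz: "minor A l \<noteq> 0"
  shows "basis_matrix r n (vec_space.row_space n A) A"
proof -
  interpret vec_space "TYPE(complex)" n .
  let ?M = "submatrix A UNIV l"
  note M = submatrix_cols[OF A l]
  have pick: "pick l t < n" if "t < r" for t
    using bij_betwE[OF bij_betw_pick[OF l]] that l by (auto simp: bracket_indices_def)
  have dist: "distinct (rows A)"
  proof (rule ccontr)
    assume "\<not> distinct (rows A)"
    then obtain i j where ij: "i < r" "j < r" "i \<noteq> j" "row A i = row A j"
      using A by (auto simp: distinct_conv_nth)
    then have "A $$ (i, t) = A $$ (j, t)" if "t < n" for t
      using A that by (metis carrier_matD(1,2) index_row(1))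
    then have "row ?M i = row ?M j"
      using ij M pick by (intro eq_vecI) auto
    then show False
      using det_identical_rows[OF M(1) ij(3,1,2)] nz by (simp add: minor_def)
  qed
  have "lin_indpt (set (rows A))"
  proof
    assume "lin_dep (set (rows A))"
    then obtain v where v: "v \<in> carrier_vec r" "v \<noteq> 0\<^sub>v r" "A\<^sup>T *\<^sub>v v = 0\<^sub>v n"
      using lin_depE[of "A\<^sup>T" r] A dist by auto
    have "(?M\<^sup>T *\<^sub>v v) $ t = (A\<^sup>T *\<^sub>v v) $ pick l t" if "t < r" for t
      using that pick[OF that] M A v(1) by (simp add: scalar_prod_def)
    then have "?M\<^sup>T *\<^sub>v v = 0\<^sub>v r"
      using v(3) M(1) pick by (intro eq_vecI) auto
    then have "det (?M\<^sup>T) = 0"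
      using v M(1) det_0_iff_vec_prod_zero[of "?M\<^sup>T" r] by auto
    then show False
      using nz M(1) by (simp add: minor_def det_transpose)
  qed
  moreover have rows: "set (rows A) \<subseteq> carrier_vec n"
    using A by (auto simp: rows_def)
  moreover have "submodule class_ring (span (set (rows A))) V"
    using span_is_submodule rows by simp
  moreover have "set (rows A) \<subseteq> span (set (rows A))"
    using in_own_span rows by simp
  moreover have "vectorspace class_ring (vs (span (set (rows A))))"
    using span_is_subspace subspace_is_vs rows by simp
  ultimately show ?thesis
    using A dist span_li_not_depend[of "set (rows A)" "span (set (rows A))"]
    unfolding basis_matrix_def row_space_def
    by (simp add: vectorspace.basis_def)
qed

lemma basis_matrix_span:
  assumes "VectorSpace.subspace class_ring y (cspace n)" and A: "basis_matrix r n y A"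
  shows "LinearCombinations.module.span class_ring (cspace n) (set (rows A)) = y"
proof -
  interpret vec_space "TYPE(complex)" n .
  have vs: "vectorspace class_ring (vs y)" and sub: "submodule class_ring y V"
    using subspace_is_vs[OF assms(1)] is_module[OF assms(1)] by auto
  have "LinearCombinations.module.span class_ring (vs y) (set (rows A)) = y" "set (rows A) \<subseteq> y"
    using A unfolding basis_matrix_def vectorspace.basis_def[OF vs] by auto
  then show ?thesis using span_li_not_depend(1)[OF _ sub] by simp
qed

lemma matroid_of_bases:
  assumes sub: "VectorSpace.subspace class_ring y (cspace n)" and A: "basis_matrix r n y A"
  shows "snd (matroid_of r n y) = {l \<in> bracket_indices r n. minor A l \<noteq> 0}"
proof -
  define B where "B = (SOME A. basis_matrix r n y A)"
  have B: "basis_matrix r n y B"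
    unfolding B_def using A by (rule someI)
  have c: "A \<in> carrier_mat r n" "B \<in> carrier_mat r n"
    using A B by (simp_all add: basis_matrix_def)
  have "minor A l = 0 \<longleftrightarrow> minor B l = 0" if "l \<in> bracket_indices r n" for l
    using minor_eq_0_cong_span[OF c that] basis_matrix_span[OF sub] A B by simp
  then show ?thesis
    unfolding matroid_of_def B_def[symmetric] column_matroid_bases[OF c(2)] by auto
qed

lemma matroid_of_row_space:
  assumes A: "A \<in> carrier_mat r n" and l: "l \<in> bracket_indices r n" and nz: "minor A l \<noteq> 0"
  shows "snd (matroid_of r n (vec_space.row_space n A)) =
         {l \<in> bracket_indices r n. minor A l \<noteq> 0}"
proof (rule matroid_of_bases)
  interpret vec_space "TYPE(complex)" n .
  show "VectorSpace.subspace class_ring (row_space A) (cspace n)"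
    unfolding row_space_def by (rule span_is_subspace) (use A in \<open>auto simp: rows_def\<close>)
qed (rule basis_matrix_row_space[OF assms])

text \<open>
  Vanishing on the matroid variety needs to be checked on the matroid stratum only, because the zero
  set of a homogeneous element is closed.
\<close>

lemma residue_class_in_matroid_ideal:
  assumes f: "f \<in> poly_carrier 3 n" and hom: "bracket_homogeneous d f"
    and van: "\<And>y Y. y \<in> Gr 3 n \<Longrightarrow> matroid_of 3 n y = matroid_of 3 n x \<Longrightarrow>
                basis_matrix 3 n y Y \<Longrightarrow> bracket_eval Y f = 0"
  shows "residue_class 3 n f \<in> matroid_ideal 3 n x"
proof -
  let ?F = "residue_class 3 n f"
  let ?Z = "{y \<in> Gr 3 n. vanishes_at 3 n ?F y}"
  have "?F \<in> coord_piece 3 n d"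
    using f hom by (auto simp: coord_piece_def)
  then have "zariski_closed 3 n ?Z"
    unfolding zariski_closed_def by (intro exI[of _ "{?F}"]) auto
  moreover have "{y \<in> Gr 3 n. matroid_of 3 n y = matroid_of 3 n x} \<subseteq> ?Z"
    using van bracket_eval_residue_class
    by (auto simp: vanishes_at_def basis_matrix_def)
  ultimately have "matroid_variety 3 n x \<subseteq> ?Z"
    unfolding matroid_variety_def zariski_closure_def by blast
  then show ?thesis
    using residue_class_in_coord_ring[OF f] by (auto simp: matroid_ideal_def)
qed

section \<open>Points and lines of the projective plane\<close>

text \<open>
  The dimension of a subspace is defined as the least size of a generating set, which says nothing
  before the subspace is known to have a finite one. A maximal independent subset provides it.
\<close>

lemma Gr_obtain_basis:
  assumes W: "W \<in> Gr r n"
  obtains S where "finite S" "card S = r" "S \<subseteq> carrier_vec n"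
    "\<not> LinearCombinations.module.lin_dep class_ring (cspace n) S"
    "LinearCombinations.module.span class_ring (cspace n) S = W"
proof -
  interpret vec_space "TYPE(complex)" n .
  have sub: "VectorSpace.subspace class_ring W V"
    and dim: "vectorspace.dim class_ring (vs W) = r"
    using W by (simp_all add: Gr_def)
  note subm = is_module[OF sub]
  have WV: "W \<subseteq> carrier_vec n"
    using submodule.subset[OF subm] by simp
  interpret W: vectorspace class_ring "vs W" by (rule subspace_is_vs[OF sub])
  have bound: "finite S \<and> card S \<le> n" if "S \<subseteq> W \<and> lin_indpt S" for S
    using li_le_dim[of S] that WV by (auto simp: dim_is_n)
  have "{} \<subseteq> W \<and> lin_indpt {}"
    by (auto simp: lin_dep_def)
  from VectorSpace.maximal_exists[of "\<lambda>S. S \<subseteq> W \<and> lin_indpt S", OF bound this]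
  obtain S where S: "finite S" "maximal S (\<lambda>S. S \<subseteq> W \<and> lin_indpt S)"
    by blast
  have SW: "S \<subseteq> W" "lin_indpt S"
    using S(2) by (auto simp: maximal_def)
  have "W.basis S"
  proof (rule W.max_li_is_basis)
    show "maximal S (\<lambda>S. S \<subseteq> carrier (vs W) \<and> W.lin_indpt S)"
      using S(2) span_li_not_depend(2)[OF _ subm] by (auto simp: maximal_def)
  qed
  then have "W.dim = card S" "span S = W"
    using W.dim_basis[OF S(1)] span_li_not_depend(1)[OF SW(1) subm] by (simp_all add: W.basis_def)
  then show thesis
    using that[of S] S SW WV dim by auto
qed

lemma span_in_Gr:
  assumes S: "finite S" "S \<subseteq> carrier_vec n"
    "\<not> LinearCombinations.module.lin_dep class_ring (cspace n) S"
  shows "LinearCombinations.module.span class_ring (cspace n) S \<in> Gr (card S) n"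
proof -
  interpret vec_space "TYPE(complex)" n .
  have sub: "VectorSpace.subspace class_ring (span S) V"
    by (rule span_is_subspace) (use S in simp)
  note subm = is_module[OF sub]
  interpret W: vectorspace class_ring "vs (span S)" by (rule subspace_is_vs[OF sub])
  have "S \<subseteq> span S" using in_own_span S by simp
  then have "W.basis S"
    using span_li_not_depend[OF _ subm] S by (simp add: W.basis_def)
  then show ?thesis
    using sub W.dim_basis[OF S(1)] by (simp add: Gr_def)
qed

lemma span_singleton:
  assumes "v \<in> carrier_vec n"
  shows "LinearCombinations.module.span class_ring (cspace n) {v} = {a \<cdot>\<^sub>v v |a :: complex. True}"
proof -
  interpret vec_space "TYPE(complex)" n .
  have "lincomb a {v} = a v \<cdot>\<^sub>v v" for a
    using assms by (simp add: lincomb_def)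
  then show ?thesis
    using finite_span[of "{v}"] assms by (auto intro: exI[of _ "\<lambda>_. _"])
qed

lemma span_pair:
  assumes "v \<in> carrier_vec n" "w \<in> carrier_vec n" "v \<noteq> w"
  shows "LinearCombinations.module.span class_ring (cspace n) {v, w} =
         {a \<cdot>\<^sub>v v + b \<cdot>\<^sub>v w |a b :: complex. True}"
proof -
  interpret vec_space "TYPE(complex)" n .
  have lc: "lincomb a {v, w} = a v \<cdot>\<^sub>v v + a w \<cdot>\<^sub>v w" for a
    using assms by (simp add: lincomb_def)
  have "{lincomb a {v, w} |a. a \<in> {v, w} \<rightarrow> UNIV} = {a \<cdot>\<^sub>v v + b \<cdot>\<^sub>v w |a b :: complex. True}"
  proof (intro equalityI subsetI)
    fix x assume "x \<in> {a \<cdot>\<^sub>v v + b \<cdot>\<^sub>v w |a b :: complex. True}"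
    then obtain a b where "x = a \<cdot>\<^sub>v v + b \<cdot>\<^sub>v w" by blast
    then have "x = lincomb (\<lambda>u. if u = v then a else b) {v, w}"
      using assms(3) by (simp add: lc)
    then show "x \<in> {lincomb a {v, w} |a. a \<in> {v, w} \<rightarrow> UNIV}" by auto
  qed (auto simp: lc)
  then show ?thesis
    using finite_span[of "{v, w}"] assms by simp
qed

text \<open>
  The vanishing of the cross product. It also holds if one of the vectors is zero.
\<close>

definition parallel :: "complex vec \<Rightarrow> complex vec \<Rightarrow> bool" where
  "parallel v w \<longleftrightarrow> v $ 0 * w $ 1 = v $ 1 * w $ 0 \<and> v $ 0 * w $ 2 = v $ 2 * w $ 0
                  \<and> v $ 1 * w $ 2 = v $ 2 * w $ 1"

lemma vec3_eq_iff:
  assumes "v \<in> carrier_vec 3" "w \<in> carrier_vec 3"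
  shows "v = w \<longleftrightarrow> v $ 0 = w $ 0 \<and> v $ 1 = w $ 1 \<and> v $ 2 = w $ 2"
proof -
  have "(\<forall>i<3. v $ i = w $ i) \<longleftrightarrow> v $ 0 = w $ 0 \<and> v $ 1 = w $ 1 \<and> v $ 2 = w $ 2"
    by (auto simp: eval_nat_numeral less_Suc_eq)
  then show ?thesis using assms by (auto simp: vec_eq_iff)
qed

lemma parallelE:
  assumes "parallel v w" "v \<in> carrier_vec 3" "w \<in> carrier_vec 3" "v \<noteq> 0\<^sub>v 3"
  obtains a where "w = a \<cdot>\<^sub>v v"
proof -
  consider "v $ 0 \<noteq> 0" | "v $ 1 \<noteq> 0" | "v $ 2 \<noteq> 0"
    using assms vec3_eq_iff[of v "0\<^sub>v 3"] by auto
  then show thesis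
  proof cases
    case 1 then show thesis
      using assms by (intro that[of "w $ 0 / v $ 0"]) (auto simp: vec3_eq_iff parallel_def field_simps)
  next
    case 2 then show thesis
      using assms by (intro that[of "w $ 1 / v $ 1"]) (auto simp: vec3_eq_iff parallel_def field_simps)
  next
    case 3 then show thesis
      using assms by (intro that[of "w $ 2 / v $ 2"]) (auto simp: vec3_eq_iff parallel_def field_simps)
  qed
qed

lemma parallel_smult: "v \<in> carrier_vec 3 \<Longrightarrow> parallel v (a \<cdot>\<^sub>v v)"
  by (simp add: parallel_def)

lemma parallel_sym: "parallel v w \<Longrightarrow> parallel w v"
  by (auto simp: parallel_def algebra_simps)

text \<open>
  Some \<open>2 \<times> 2\<close> minor of the two vectors is nonzero; Cramer's rule for it gives the coefficients, and
  the vanishing determinant says that they also fit the third coordinate.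
\<close>

lemma det3_eq_0_iff_combination:
  assumes c: "v \<in> carrier_vec 3" "w \<in> carrier_vec 3" "x \<in> carrier_vec 3" and np: "\<not> parallel v w"
  shows "det3 v w x = 0 \<longleftrightarrow> (\<exists>a b. x = a \<cdot>\<^sub>v v + b \<cdot>\<^sub>v w)"
proof
  assume d: "det3 v w x = 0"
  have cramer: "\<exists>a b. x $ i = a * v $ i + b * w $ i \<and> x $ j = a * v $ j + b * w $ j \<and>
      x $ k = a * v $ k + b * w $ k"
    if D: "v $ i * w $ j - v $ j * w $ i \<noteq> 0"
      and k: "(v $ i * w $ j - v $ j * w $ i) * x $ k =
        (x $ i * w $ j - x $ j * w $ i) * v $ k + (v $ i * x $ j - v $ j * x $ i) * w $ k"
    for i j k
  proof -
    let ?D = "v $ i * w $ j - v $ j * w $ i"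
    let ?a = "(x $ i * w $ j - x $ j * w $ i) / ?D"
    let ?b = "(v $ i * x $ j - v $ j * x $ i) / ?D"
    have "x $ i = ?a * v $ i + ?b * w $ i" "x $ j = ?a * v $ j + ?b * w $ j"
      using D by (simp_all add: divide_simps) (simp_all add: algebra_simps)
    moreover have "x $ k = ?a * v $ k + ?b * w $ k"
    proof -
      have "x $ k = (?D * x $ k) / ?D" using D by simp
      then show ?thesis unfolding k by (simp add: add_divide_distrib)
    qed
    ultimately show ?thesis by blast
  qed
  consider "v $ 0 * w $ 1 - v $ 1 * w $ 0 \<noteq> 0" | "v $ 0 * w $ 2 - v $ 2 * w $ 0 \<noteq> 0"
    | "v $ 1 * w $ 2 - v $ 2 * w $ 1 \<noteq> 0"
    using np by (auto simp: parallel_def)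
  then have "\<exists>a b. x $ 0 = a * v $ 0 + b * w $ 0 \<and> x $ 1 = a * v $ 1 + b * w $ 1 \<and>
      x $ 2 = a * v $ 2 + b * w $ 2"
  proof cases
    case 1 from cramer[OF 1, of 2] d show ?thesis by (auto simp: det3_def algebra_simps)
  next
    case 2 from cramer[OF 2, of 1] d show ?thesis by (fastforce simp: det3_def algebra_simps)
  next
    case 3 from cramer[OF 3, of 0] d show ?thesis by (fastforce simp: det3_def algebra_simps)
  qed
  then show "\<exists>a b. x = a \<cdot>\<^sub>v v + b \<cdot>\<^sub>v w"
    using c by (auto simp: vec3_eq_iff)
next
  assume "\<exists>a b. x = a \<cdot>\<^sub>v v + b \<cdot>\<^sub>v w"
  then show "det3 v w x = 0"
    using c by (auto simp: det3_def algebra_simps)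
qed

definition plane :: "complex vec \<Rightarrow> complex vec \<Rightarrow> complex vec set" where
  "plane v w = {x \<in> carrier_vec 3. det3 v w x = 0}"

lemma plane_eq_span:
  assumes "v \<in> carrier_vec 3" "w \<in> carrier_vec 3" "\<not> parallel v w"
  shows "plane v w = LinearCombinations.module.span class_ring (cspace 3) {v, w}"
proof -
  have "v \<noteq> w" using assms(3) by (auto simp: parallel_def)
  then show ?thesis
    using span_pair[of v 3 w] det3_eq_0_iff_combination[of v w] assms
    by (simp add: plane_def set_eq_iff) (metis add_carrier_vec smult_carrier_vec)
qed

lemma lin_dep_singleton:
  assumes "v \<in> carrier_vec 3"
  shows "LinearCombinations.module.lin_dep class_ring (cspace 3) {v} \<longleftrightarrow> v = 0\<^sub>v 3"
proof -
  interpret vec_space "TYPE(complex)" 3 .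
  have "lin_dep {v} \<longleftrightarrow> (\<exists>a. a \<noteq> 0 \<and> a \<cdot>\<^sub>v v = 0\<^sub>v 3)"
  proof
    assume "lin_dep {v}"
    then obtain a where "a v \<noteq> 0" "lincomb a {v} = 0\<^sub>v 3"
      using finite_lin_dep[of "{v}"] assms by auto
    then show "\<exists>a. a \<noteq> 0 \<and> a \<cdot>\<^sub>v v = 0\<^sub>v 3"
      using assms by (auto simp: lincomb_def)
  next
    assume "\<exists>a. a \<noteq> 0 \<and> a \<cdot>\<^sub>v v = 0\<^sub>v 3"
    then obtain a where "a \<noteq> 0" "a \<cdot>\<^sub>v v = 0\<^sub>v 3" by blast
    then show "lin_dep {v}"
      using assms by (intro lin_dep_crit[where A = "{v}" and a = "\<lambda>_. a" and v = v]) (auto simp: lincomb_def)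
  qed
  also have "\<dots> \<longleftrightarrow> v = 0\<^sub>v 3"
    using assms by (auto simp: vec3_eq_iff intro: exI[of _ 1])
  finally show ?thesis .
qed

lemma lin_dep_pair:
  assumes c: "v \<in> carrier_vec 3" "w \<in> carrier_vec 3" and "v \<noteq> w"
  shows "LinearCombinations.module.lin_dep class_ring (cspace 3) {v, w} \<longleftrightarrow> parallel v w"
proof -
  interpret vec_space "TYPE(complex)" 3 .
  have lc: "lincomb a {v, w} = a v \<cdot>\<^sub>v v + a w \<cdot>\<^sub>v w" for a
    using assms by (simp add: lincomb_def)
  show ?thesis
  proof
    assume "lin_dep {v, w}"
    then obtain a u where a: "lincomb a {v, w} = 0\<^sub>v 3" "u \<in> {v, w}" "a u \<noteq> 0"
      using finite_lin_dep[of "{v, w}"] assms by auto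
    then have eq: "a v * v $ i + a w * w $ i = 0" if "i < 3" for i
      using that c by (auto simp: lc dest!: arg_cong[of _ "0\<^sub>v 3" "\<lambda>u. u $ i"])
    have e: "a v * v $ 0 + a w * w $ 0 = 0" "a v * v $ 1 + a w * w $ 1 = 0"
      "a v * v $ 2 + a w * w $ 2 = 0"
      by (simp_all add: eq)
    have "a v * (v $ i * w $ j - v $ j * w $ i) = 0" "a w * (v $ i * w $ j - v $ j * w $ i) = 0"
      if "a v * v $ i + a w * w $ i = 0" "a v * v $ j + a w * w $ j = 0" for i j
    proof -
      have "a v * (v $ i * w $ j - v $ j * w $ i) =
          (a v * v $ i + a w * w $ i) * w $ j - (a v * v $ j + a w * w $ j) * w $ i"
        "a w * (v $ i * w $ j - v $ j * w $ i) =
          (a v * v $ j + a w * w $ j) * v $ i - (a v * v $ i + a w * w $ i) * v $ j"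
        by (simp_all add: algebra_simps)
      then show "a v * (v $ i * w $ j - v $ j * w $ i) = 0"
        "a w * (v $ i * w $ j - v $ j * w $ i) = 0"
        unfolding that by simp_all
    qed
    from this[OF e(1,2)] this[OF e(1,3)] this[OF e(2,3)] show "parallel v w"
      using a(2,3) by (auto simp: parallel_def)
  next
    assume p: "parallel v w"
    show "lin_dep {v, w}"
    proof (cases "v = 0\<^sub>v 3")
      case True
      then show ?thesis
        using lin_dep_singleton[OF c(1)] supset_ld_is_ld[of "{v}" "{v, w}"] by simp
    next
      case False
      then obtain a where "w = a \<cdot>\<^sub>v v" using parallelE[OF p c] by blast
      then have "lincomb (\<lambda>u. if u = v then a else - 1) {v, w} = 0\<^sub>v 3"
        using c \<open>v \<noteq> w\<close> by (auto simp: lc vec3_eq_iff)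
      then show ?thesis
        using \<open>v \<noteq> w\<close>
        by (intro lin_dep_crit[where A = "{v, w}" and a = "\<lambda>u. if u = v then a else - 1" and v = w]) auto
    qed
  qed
qed

lemma plane_in_proj_lines:
  assumes "v \<in> carrier_vec 3" "w \<in> carrier_vec 3" "\<not> parallel v w"
  shows "plane v w \<in> proj_lines"
proof -
  have "v \<noteq> w" using assms(3) by (auto simp: parallel_def)
  then show ?thesis
    using span_in_Gr[of "{v, w}" 3] assms by (simp add: plane_eq_span lin_dep_pair numeral_2_eq_2)
qed

lemma proj_line_obtain_plane:
  assumes "M \<in> proj_lines"
  obtains v w where "v \<in> carrier_vec 3" "w \<in> carrier_vec 3" "\<not> parallel v w" "M = plane v w"
proof -
  obtain S where S: "card S = 2" "S \<subseteq> carrier_vec 3"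
    "\<not> LinearCombinations.module.lin_dep class_ring (cspace 3) S"
    "LinearCombinations.module.span class_ring (cspace 3) S = M"
    using Gr_obtain_basis[OF assms] by blast
  then obtain v w where "S = {v, w}" "v \<noteq> w" by (auto simp: card_2_iff)
  with S that[of v w] show thesis
    by (simp add: lin_dep_pair plane_eq_span)
qed

lemma proj_point_eq: "v \<in> carrier_vec 3 \<Longrightarrow> proj_point v = {a \<cdot>\<^sub>v v |a. True}"
  by (simp add: proj_point_def span_singleton)

lemma proj_point_self: "v \<in> carrier_vec 3 \<Longrightarrow> v \<in> proj_point v"
  unfolding proj_point_eq mem_Collect_eq by (rule exI[of _ 1]) simp

lemma proj_point_in_proj_points:
  "v \<in> carrier_vec 3 \<Longrightarrow> v \<noteq> 0\<^sub>v 3 \<Longrightarrow> proj_point v \<in> proj_points"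
  using span_in_Gr[of "{v}" 3] by (simp add: lin_dep_singleton proj_point_def)

lemma proj_point_obtain_vec:
  assumes "p \<in> proj_points"
  obtains v where "v \<in> carrier_vec 3" "v \<noteq> 0\<^sub>v 3" "p = proj_point v"
proof -
  obtain S where S: "card S = 1" "S \<subseteq> carrier_vec 3"
    "\<not> LinearCombinations.module.lin_dep class_ring (cspace 3) S"
    "LinearCombinations.module.span class_ring (cspace 3) S = p"
    using Gr_obtain_basis[OF assms] by blast
  then obtain v where "S = {v}" by (auto simp: card_1_singleton_iff)
  with S that[of v] show thesis
    by (simp add: lin_dep_singleton proj_point_def)
qed

lemma proj_point_nonzero:
  assumes "v \<in> carrier_vec 3" "proj_point v \<in> proj_points"
  shows "v \<noteq> 0\<^sub>v 3"
proof
  assume v: "v = 0\<^sub>v 3"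
  obtain w where "w \<in> carrier_vec 3" "w \<noteq> 0\<^sub>v 3" "proj_point v = proj_point w"
    using proj_point_obtain_vec[OF assms(2)] by blast
  moreover from this have "w \<in> {a \<cdot>\<^sub>v v |a. True}"
    using proj_point_self[of w] proj_point_eq[OF assms(1)] by simp
  ultimately show False by (auto simp: v vec3_eq_iff)
qed

lemma proj_point_eq_iff_parallel:
  assumes "v \<in> carrier_vec 3" "w \<in> carrier_vec 3" "v \<noteq> 0\<^sub>v 3" "w \<noteq> 0\<^sub>v 3"
  shows "proj_point v = proj_point w \<longleftrightarrow> parallel v w"
proof
  assume "proj_point v = proj_point w"
  then have "w \<in> {a \<cdot>\<^sub>v v |a. True}"
    using proj_point_eq[of v] proj_point_self[of w] assms by simp
  then show "parallel v w" using parallel_smult[OF assms(1)] by auto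
next
  have sub: "proj_point w \<subseteq> proj_point v"
    if vw: "parallel v w" "v \<in> carrier_vec 3" "w \<in> carrier_vec 3" "v \<noteq> 0\<^sub>v 3" for v w
  proof -
    obtain a where "w = a \<cdot>\<^sub>v v" using parallelE[OF vw] by blast
    then show ?thesis using vw(2,3) by (auto simp: proj_point_eq smult_smult_assoc)
  qed
  assume "parallel v w"
  then show "proj_point v = proj_point w"
    using sub[of v w] sub[of w v] parallel_sym assms by blast
qed

lemma proj_point_subset_plane:
  assumes "u \<in> carrier_vec 3"
  shows "proj_point u \<subseteq> plane v w \<longleftrightarrow> det3 v w u = 0"
proof
  assume "proj_point u \<subseteq> plane v w"
  then show "det3 v w u = 0"
    using proj_point_self[OF assms] by (auto simp: plane_def)
next
  have "det3 v w (a \<cdot>\<^sub>v u) = a * det3 v w u" for a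
    using assms by (simp add: det3_def algebra_simps)
  then show "det3 v w u = 0 \<Longrightarrow> proj_point u \<subseteq> plane v w"
    using assms by (auto simp: proj_point_eq plane_def)
qed

text \<open>
  Passing from one spanning pair of the line to another multiplies its equation \<open>det3 v w x = 0\<close> by
  the determinant of the change of basis, which is nonzero if the new pair is independent.
\<close>

lemma proj_line_eq_plane:
  assumes M: "M \<in> proj_lines" and v: "v \<in> carrier_vec 3" and w: "w \<in> carrier_vec 3"
    and np: "\<not> parallel v w" and p: "proj_point v \<subseteq> M" "proj_point w \<subseteq> M"
  shows "M = plane v w"
proof -
  obtain a b where ab: "a \<in> carrier_vec 3" "b \<in> carrier_vec 3" "\<not> parallel a b" "M = plane a b"
    using proj_line_obtain_plane[OF M] by blast
  obtain s t where v': "v = s \<cdot>\<^sub>v a + t \<cdot>\<^sub>v b"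
    using p(1) ab v by (auto simp: proj_point_subset_plane det3_eq_0_iff_combination)
  obtain s' t' where w': "w = s' \<cdot>\<^sub>v a + t' \<cdot>\<^sub>v b"
    using p(2) ab w by (auto simp: proj_point_subset_plane det3_eq_0_iff_combination)
  have "det3 v w x = (s * t' - t * s') * det3 a b x" for x
    using ab unfolding v' w' by (simp add: det3_def algebra_simps)
  moreover have "s * t' - t * s' \<noteq> 0"
  proof
    assume "s * t' - t * s' = 0"
    then have z: "s * t' = t * s'" by simp
    have "v $ i * w $ j - v $ j * w $ i = (s * t' - t * s') * (a $ i * b $ j - a $ j * b $ i)"
      if "i < 3" "j < 3" for i j
      using ab that unfolding v' w' by (simp add: algebra_simps)
    then have "v $ i * w $ j = v $ j * w $ i" if "i < 3" "j < 3" for i j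
      using that z by simp
    then show False using np by (simp add: parallel_def)
  qed
  ultimately show ?thesis using ab by (simp add: plane_def)
qed

lemma proj_line_unique:
  assumes "M \<in> proj_lines" "M' \<in> proj_lines" "p \<noteq> q"
    "p \<in> points_on M" "q \<in> points_on M" "p \<in> points_on M'" "q \<in> points_on M'"
  shows "M = M'"
proof -
  obtain v w where "v \<in> carrier_vec 3" "v \<noteq> 0\<^sub>v 3" "p = proj_point v"
    "w \<in> carrier_vec 3" "w \<noteq> 0\<^sub>v 3" "q = proj_point w"
    using assms(4,5) by (metis (no_types, lifting) mem_Collect_eq points_on_def proj_point_obtain_vec)
  with assms show ?thesis
    using proj_line_eq_plane[of M v w] proj_line_eq_plane[of M' v w] proj_point_eq_iff_parallel[of v w]
    by (auto simp: points_on_def)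
qed

text \<open>
  The points spanned by \<open>v + t w\<close> for varying \<open>t\<close> are distinct.
\<close>

lemma infinite_points_on:
  assumes "M \<in> proj_lines"
  shows "infinite (points_on M)"
proof -
  obtain v w where vw: "v \<in> carrier_vec 3" "w \<in> carrier_vec 3" "\<not> parallel v w" "M = plane v w"
    using proj_line_obtain_plane[OF assms] by blast
  let ?u = "\<lambda>t :: complex. v + t \<cdot>\<^sub>v w"
  have nz: "?u t \<noteq> 0\<^sub>v 3" for t
  proof
    assume z: "?u t = 0\<^sub>v 3"
    have "v $ i = - t * w $ i" if "i < 3" for i
      using arg_cong[OF z, of "\<lambda>u. u $ i"] vw that by (simp add: add_eq_0_iff2)
    then show False using vw(3) by (simp add: parallel_def)
  qed
  have cross: "?u s $ i * ?u t $ j - ?u s $ j * ?u t $ i = (t - s) * (v $ i * w $ j - v $ j * w $ i)"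
    if "i < 3" "j < 3" for i j s t
    using vw that by (simp add: algebra_simps)
  have "s = t" if "parallel (?u s) (?u t)" for s t
  proof (rule ccontr)
    assume "s \<noteq> t"
    moreover have "(t - s) * (v $ 0 * w $ 1 - v $ 1 * w $ 0) = 0"
      "(t - s) * (v $ 0 * w $ 2 - v $ 2 * w $ 0) = 0" "(t - s) * (v $ 1 * w $ 2 - v $ 2 * w $ 1) = 0"
      using that cross[of 0 1 s t] cross[of 0 2 s t] cross[of 1 2 s t] unfolding parallel_def by simp_all
    ultimately show False using vw(3) by (auto simp: parallel_def)
  qed
  then have "inj (\<lambda>t. proj_point (?u t))"
    using proj_point_eq_iff_parallel nz vw by (intro injI) auto
  then have "infinite (range (\<lambda>t. proj_point (?u t)))"
    using infinite_UNIV_char_0 finite_imageD by blast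
  moreover have "proj_point (?u t) \<in> points_on M" for t
  proof -
    have "det3 v w (?u t) = 0" using vw by (simp add: det3_def algebra_simps)
    then show ?thesis
      using vw nz[of t] proj_point_in_proj_points[of "?u t"] proj_point_subset_plane[of "?u t" v w]
      by (simp add: points_on_def)
  qed
  then have "range (\<lambda>t. proj_point (?u t)) \<subseteq> points_on M" by blast
  ultimately show ?thesis using finite_subset by blast
qed

lemma collinear_iff_det3:
  assumes "u \<in> carrier_vec 3" "v \<in> carrier_vec 3" "w \<in> carrier_vec 3"
    "proj_point u \<in> proj_points" "proj_point v \<in> proj_points" "proj_point w \<in> proj_points"
    "proj_point u \<noteq> proj_point v"
  shows "det3 u v w = 0 \<longleftrightarrow> (\<exists>M\<in>proj_lines. {proj_point u, proj_point v, proj_point w} \<subseteq> points_on M)"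
proof -
  have np: "\<not> parallel u v"
    using assms proj_point_eq_iff_parallel proj_point_nonzero by blast
  have uv: "det3 u v u = 0" "det3 u v v = 0" by (simp_all add: det3_def algebra_simps)
  show ?thesis
  proof
    assume "det3 u v w = 0"
    then show "\<exists>M\<in>proj_lines. {proj_point u, proj_point v, proj_point w} \<subseteq> points_on M"
      using plane_in_proj_lines[OF assms(1,2) np] assms uv
      by (intro bexI[of _ "plane u v"]) (auto simp: points_on_def proj_point_subset_plane)
  next
    assume "\<exists>M\<in>proj_lines. {proj_point u, proj_point v, proj_point w} \<subseteq> points_on M"
    then obtain M where M: "M \<in> proj_lines" "proj_point u \<subseteq> M" "proj_point v \<subseteq> M" "proj_point w \<subseteq> M"
      by (auto simp: points_on_def)
    then show "det3 u v w = 0"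
      using proj_line_eq_plane[OF M(1) assms(1,2) np M(2,3)] assms(3)
      by (simp add: proj_point_subset_plane)
  qed
qed

section \<open>The Pascal polynomial\<close>

text \<open>
  The cross product of \<open>a \<times> b\<close> and \<open>d \<times> e\<close>, expanded by the triple product formula: it spans the
  common point of the lines \<open>ab\<close> and \<open>de\<close> if these lines are distinct, and it is zero if they
  coincide. In this form its coefficients are brackets.
\<close>

definition meet :: "complex vec \<Rightarrow> complex vec \<Rightarrow> complex vec \<Rightarrow> complex vec \<Rightarrow> complex vec" where
  "meet a b d e = vec 3 (\<lambda>i. det3 a d e * b $ i - det3 b d e * a $ i)"

text \<open>
  With \<open>u = a \<times> b\<close> and \<open>v = d \<times> e\<close>, Grassmann's identity \<open>(u \<times> v) \<times> p = (u \<bullet> p) v - (v \<bullet> p) u\<close> has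
  the two given determinants as its coefficients.
\<close>

lemma parallel_meet:
  assumes 1: "det3 a b p = 0" and 2: "det3 d e p = 0"
  shows "parallel p (meet a b d e)"
proof -
  have "p $ 0 * meet a b d e $ 1 - p $ 1 * meet a b d e $ 0 =
      (a $ 0 * b $ 1 - a $ 1 * b $ 0) * det3 d e p - (d $ 0 * e $ 1 - d $ 1 * e $ 0) * det3 a b p"
    "p $ 0 * meet a b d e $ 2 - p $ 2 * meet a b d e $ 0 =
      (a $ 0 * b $ 2 - a $ 2 * b $ 0) * det3 d e p - (d $ 0 * e $ 2 - d $ 2 * e $ 0) * det3 a b p"
    "p $ 1 * meet a b d e $ 2 - p $ 2 * meet a b d e $ 1 =
      (a $ 1 * b $ 2 - a $ 2 * b $ 1) * det3 d e p - (d $ 1 * e $ 2 - d $ 2 * e $ 1) * det3 a b p"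
    by (simp_all add: meet_def) (simp_all add: det3_def algebra_simps)
  then show ?thesis unfolding 1 2 by (simp add: parallel_def)
qed

text \<open>
  By multilinearity; four of the eight terms have a repeated argument.
\<close>

lemma det3_meets:
  "det3 (meet a b d e) (meet b c e f) (meet c d f a) =
     det3 a d e * det3 b e f * det3 c f a * det3 b c d
   - det3 b d e * det3 b e f * det3 c f a * det3 a c d
   + det3 b d e * det3 c e f * det3 c f a * det3 a b d
   - det3 b d e * det3 c e f * det3 d f a * det3 a b c"
proof -
  have "det3 (vec 3 (\<lambda>i. x * b $ i - x' * a $ i)) (vec 3 (\<lambda>i. y * c $ i - y' * b $ i))
      (vec 3 (\<lambda>i. z * d $ i - z' * c $ i)) =
      x * y * z * det3 b c d - x' * y * z * det3 a c d + x' * y' * z * det3 a b d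
      - x' * y' * z' * det3 a b c" for x x' y y' z z'
    by (simp add: det3_def algebra_simps)
  then show ?thesis by (simp add: meet_def)
qed

lemma det3_eq_0_cong_parallel:
  assumes "parallel p p'" "parallel q q'" "parallel r r'" "det3 p q r = 0"
    and "{p, q, r} \<subseteq> carrier_vec 3 - {0\<^sub>v 3}" "{p', q', r'} \<subseteq> carrier_vec 3"
  shows "det3 p' q' r' = 0"
proof -
  obtain x y z where "p' = x \<cdot>\<^sub>v p" "q' = y \<cdot>\<^sub>v q" "r' = z \<cdot>\<^sub>v r"
    using parallelE[OF assms(1)] parallelE[OF assms(2)] parallelE[OF assms(3)] assms(5,6)
    by (metis Diff_iff insert_subset singletonI)
  moreover have "p \<in> carrier_vec 3" "q \<in> carrier_vec 3" "r \<in> carrier_vec 3"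
    using assms(5) by auto
  ultimately have "det3 p' q' r' = x * y * z * det3 p q r"
    by (simp add: det3_def algebra_simps)
  then show ?thesis using assms(4) by simp
qed

text \<open>
  The bracket form of Pascal's condition on a hexagon \<open>abcdef\<close>: its three pairs of opposite sides
  meet in collinear points. It vanishes exactly if the six points lie on a conic.
\<close>

definition pascal_poly :: "nat \<Rightarrow> nat \<Rightarrow> nat \<Rightarrow> nat \<Rightarrow> nat \<Rightarrow> nat \<Rightarrow> bracket_poly" where
  "pascal_poly a b c d e f =
     bracket_seq [a, d, e] * bracket_seq [b, e, f] * bracket_seq [c, f, a] * bracket_seq [b, c, d]
   - bracket_seq [b, d, e] * bracket_seq [b, e, f] * bracket_seq [c, f, a] * bracket_seq [a, c, d]
   + bracket_seq [b, d, e] * bracket_seq [c, e, f] * bracket_seq [c, f, a] * bracket_seq [a, b, d]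
   - bracket_seq [b, d, e] * bracket_seq [c, e, f] * bracket_seq [d, f, a] * bracket_seq [a, b, c]"

lemma bracket_eval_pascal_poly:
  assumes "Y \<in> carrier_mat 3 n" "{a, b, c, d, e, f} \<subseteq> {..<n}"
  shows "bracket_eval Y (pascal_poly a b c d e f) =
    det3 (meet (col Y a) (col Y b) (col Y d) (col Y e)) (meet (col Y b) (col Y c) (col Y e) (col Y f))
      (meet (col Y c) (col Y d) (col Y f) (col Y a))"
  unfolding det3_meets pascal_poly_def using assms(2)
  by (simp add: bracket_eval_bracket_seq[OF assms(1)])

lemma pascal_poly_in_carrier:
  assumes "{a, b, c, d, e, f} \<subseteq> {..<n}"
  shows "pascal_poly a b c d e f \<in> poly_carrier 3 n"
  unfolding pascal_poly_def
  by (intro poly_carrier_closed bracket_seq_in_carrier) (use assms in auto)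

lemma bracket_homogeneous_bracket_seq: "bracket_homogeneous 1 (bracket_seq js)"
proof -
  have "bracket_homogeneous 0 ((- 1) ^ t)" for t
    using bracket_homogeneous_power[OF bracket_homogeneous_uminus[OF bracket_homogeneous_one], of t] by simp
  then have "bracket_homogeneous (0 + 1) ((- 1) ^ t * bracket l)" for t l
    by (intro bracket_homogeneous_mult bracket_homogeneous_bracket)
  then show ?thesis by (simp add: bracket_seq_def bracket_homogeneous_def)
qed

lemma bracket_homogeneous_pascal_poly: "bracket_homogeneous 4 (pascal_poly a b c d e f)"
proof -
  have four: "4 = (1 + 1 + 1 + 1 :: nat)" by simp
  have "bracket_homogeneous 4 (bracket_seq s * bracket_seq t * bracket_seq u * bracket_seq v)"
    for s t u v
    unfolding four by (intro bracket_homogeneous_mult bracket_homogeneous_bracket_seq)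
  then show ?thesis
    unfolding pascal_poly_def by (intro bracket_homogeneous_add bracket_homogeneous_diff)
qed

lemma det3_zero: "det3 (0\<^sub>v 3) v w = 0"
  by (simp add: det3_def)

lemma det3_eq_0_iff_minor:
  assumes "Y \<in> carrier_mat 3 n" "x < n" "y < n" "z < n" "distinct [x, y, z]"
  shows "det3 (col Y x) (col Y y) (col Y z) = 0 \<longleftrightarrow> minor Y {x, y, z} = 0"
  unfolding bracket_eval_bracket_seq[OF assms(1-4), symmetric] using assms(5)
  by (simp add: bracket_seq_3)

text \<open>
  This transfers incidences between two matrices with the same matroid, also for repeated indices,
  where both determinants are zero.
\<close>

lemma det3_eq_0_cong_minors:
  assumes "Y \<in> carrier_mat 3 n" "Z \<in> carrier_mat 3 n"
    and minors: "\<And>l. l \<in> bracket_indices 3 n \<Longrightarrow> minor Y l = 0 \<longleftrightarrow> minor Z l = 0"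
    and lt: "x < n" "y < n" "z < n"
  shows "det3 (col Y x) (col Y y) (col Y z) = 0 \<longleftrightarrow> det3 (col Z x) (col Z y) (col Z z) = 0"
proof (cases "distinct [x, y, z]")
  case True
  then have "{x, y, z} \<in> bracket_indices 3 n"
    using lt by (auto simp: bracket_indices_def)
  then show ?thesis
    using det3_eq_0_iff_minor[OF assms(1) lt True] det3_eq_0_iff_minor[OF assms(2) lt True] minors
    by simp
next
  case False
  then show ?thesis by (auto simp: det3_def algebra_simps)
qed

text \<open>
  All but the six columns of the hexagon are zero. Taking \<open>b\<close> on the line \<open>de\<close> makes \<open>[bde]\<close> vanish
  and leaves only the first of the four terms of the Pascal polynomial.
\<close>

lemma pascal_witness:
  assumes lt: "{a, b, c, d, e, f} \<subseteq> {..<n}" and dist: "distinct [a, b, c, d, e, f]"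
  obtains B where "B \<in> carrier_mat 3 n"
    "\<And>j. j < n \<Longrightarrow> j \<notin> {a, b, c, d, e, f} \<Longrightarrow> col B j = 0\<^sub>v 3"
    "bracket_eval B (pascal_poly a b c d e f) = 1" "bracket_eval B (bracket_seq [a, d, e]) = 1"
proof -
  define g :: "nat \<Rightarrow> complex vec" where "g j = vec_of_list
     (if j = a then [0, 0, 1] else if j = b then [1, 1, 0] else if j = c then [1, 0, 1]
      else if j = d then [1, 0, 0] else if j = e then [0, 1, 0] else if j = f then [0, 1, 1]
      else [0, 0, 0])" for j
  define B where "B = mat_of_cols 3 (map g [0..<n])"
  have B: "B \<in> carrier_mat 3 n"
    unfolding B_def using mat_of_cols_carrier(1)[of 3 "map g [0..<n]"] by (simp only: length_map length_upt diff_zero)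
  have g3: "g j \<in> carrier_vec 3" for j
    unfolding g_def by (rule carrier_vecI) (simp split: if_split)
  have col: "col B j = g j" if "j < n" for j
    unfolding B_def using that g3
    by (subst col_mat_of_cols) (simp_all only: length_map length_upt diff_zero nth_map nth_upt add_0)
  have g: "g a = vec_of_list [0, 0, 1]" "g b = vec_of_list [1, 1, 0]" "g c = vec_of_list [1, 0, 1]"
    "g d = vec_of_list [1, 0, 0]" "g e = vec_of_list [0, 1, 0]" "g f = vec_of_list [0, 1, 1]"
    using dist by (auto simp: g_def)
  have eval: "bracket_eval B (bracket_seq [x, y, z]) = det3 (g x) (g y) (g z)"
    if "{x, y, z} \<subseteq> {a, b, c, d, e, f}" for x y z
  proof -
    have "x < n" "y < n" "z < n" using that lt by auto
    then show ?thesis by (simp add: bracket_eval_bracket_seq[OF B] col)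
  qed
  have dets: "det3 (g a) (g d) (g e) = 1" "det3 (g b) (g d) (g e) = 0" "det3 (g b) (g e) (g f) = 1"
    "det3 (g c) (g f) (g a) = 1" "det3 (g b) (g c) (g d) = 1"
  proof -
    have entries: "vec_of_list [x, y, z] $ 0 = x" "vec_of_list [x, y, z] $ 1 = y"
      "vec_of_list [x, y, z] $ 2 = z" for x y z :: complex
      by (simp_all add: numeral_2_eq_2)
    show "det3 (g a) (g d) (g e) = 1" "det3 (g b) (g d) (g e) = 0" "det3 (g b) (g e) (g f) = 1"
      "det3 (g c) (g f) (g a) = 1" "det3 (g b) (g c) (g d) = 1"
      unfolding g det3_def entries by simp_all
  qed
  show thesis
  proof
    show "col B j = 0\<^sub>v 3" if "j < n" "j \<notin> {a, b, c, d, e, f}" for j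
      using that g3[of j] by (simp add: col) (simp add: g_def vec3_eq_iff numeral_2_eq_2)
    show "bracket_eval B (pascal_poly a b c d e f) = 1" "bracket_eval B (bracket_seq [a, d, e]) = 1"
      unfolding pascal_poly_def by (simp_all add: eval dets)
  qed (fact B)
qed

text \<open>
  In the situation of Pascal's theorem, with opposite sides meeting in the collinear points \<open>p\<close>, \<open>q\<close>,
  \<open>r\<close>, the incidences are part of the matroid, so the Pascal polynomial vanishes on the whole stratum.
  The brackets of a hexagon in general position are no nonbases; hence every nonbasis bracket
  contains a column outside the hexagon and vanishes at the witness matrix. The factor \<open>[ade]\<close>, a bracket
  with value 1 at that matrix, raises the degree without spoiling either property.
\<close>

lemma nontrivial_pascal_multiple:
  assumes A: "A \<in> carrier_mat 3 n"
    and hex: "{a, b, c, d, e, f} \<subseteq> {..<n}" "distinct [a, b, c, d, e, f]"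
    and lt: "p < n" "q < n" "r < n"
    and generic: "\<And>l. l \<subseteq> {a, b, c, d, e, f} \<Longrightarrow> card l = 3 \<Longrightarrow> minor A l \<noteq> 0"
    and p: "det3 (col A a) (col A b) (col A p) = 0" "det3 (col A d) (col A e) (col A p) = 0"
    and q: "det3 (col A b) (col A c) (col A q) = 0" "det3 (col A e) (col A f) (col A q) = 0"
    and r: "det3 (col A c) (col A d) (col A r) = 0" "det3 (col A f) (col A a) (col A r) = 0"
    and pqr: "det3 (col A p) (col A q) (col A r) = 0"
    and nz: "\<And>s. s \<in> {p, q, r} \<Longrightarrow> \<exists>t<n. \<exists>u<n. det3 (col A s) (col A t) (col A u) \<noteq> 0"
    and D: "D \<ge> 4"
  shows "\<exists>F\<in>coord_piece 3 n D. nontrivial 3 n (vec_space.row_space n A) F"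
proof -
  let ?x = "vec_space.row_space n A"
  define h where "h = pascal_poly a b c d e f * bracket_seq [a, d, e] ^ (D - 4)"
  have abc: "a < n" "b < n" "c < n" "d < n" "e < n" "f < n" using hex by auto
  have h: "h \<in> poly_carrier 3 n"
    unfolding h_def using abc
    by (intro poly_carrier_closed pascal_poly_in_carrier bracket_seq_in_carrier) auto
  have "bracket_homogeneous (4 + 1 * (D - 4)) h"
    unfolding h_def
    by (intro bracket_homogeneous_mult bracket_homogeneous_power bracket_homogeneous_pascal_poly
        bracket_homogeneous_bracket_seq)
  then have hom: "bracket_homogeneous D h" using D by simp
  have "{a, d, e} \<in> bracket_indices 3 n" "minor A {a, d, e} \<noteq> 0"
    using generic[of "{a, d, e}"] hex by (auto simp: bracket_indices_def)
  note bases = matroid_of_row_space[OF A this]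
  have "residue_class 3 n h \<in> matroid_ideal 3 n ?x"
  proof (rule residue_class_in_matroid_ideal[OF h hom])
    fix y Y assume y: "y \<in> Gr 3 n" "matroid_of 3 n y = matroid_of 3 n ?x" "basis_matrix 3 n y Y"
    then have Y: "Y \<in> carrier_mat 3 n" by (simp add: basis_matrix_def)
    have "{l \<in> bracket_indices 3 n. minor Y l \<noteq> 0} = {l \<in> bracket_indices 3 n. minor A l \<noteq> 0}"
      using matroid_of_bases[of y n 3 Y] y bases by (simp add: Gr_def)
    then have minors: "minor Y l = 0 \<longleftrightarrow> minor A l = 0" if "l \<in> bracket_indices 3 n" for l
      using that by blast
    have cong: "det3 (col Y s) (col Y t) (col Y u) = 0 \<longleftrightarrow> det3 (col A s) (col A t) (col A u) = 0"
      if "s < n" "t < n" "u < n" for s t u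
      by (rule det3_eq_0_cong_minors[OF Y A minors that])
    have zeroY: "det3 (col Y s) (col Y t) (col Y u) = 0"
      if "det3 (col A s) (col A t) (col A u) = 0" "s < n" "t < n" "u < n" for s t u
      using cong[OF that(2-4)] that(1) by (rule iffD2)
    \<comment> \<open>A zero column belongs to no basis.\<close>
    have nonzero: "col Y s \<in> carrier_vec 3 - {0\<^sub>v 3}" if s: "s \<in> {p, q, r}" for s
    proof -
      have "s < n" using s lt by auto
      obtain t u where tu: "t < n" "u < n" "det3 (col A s) (col A t) (col A u) \<noteq> 0"
        using nz[OF s] by blast
      then have "det3 (col Y s) (col Y t) (col Y u) \<noteq> 0"
        using cong[OF \<open>s < n\<close> tu(1,2)] by simp
      then have "col Y s \<noteq> 0\<^sub>v 3" by (metis det3_zero)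
      then show ?thesis using Y \<open>s < n\<close> by auto
    qed
    have "bracket_eval Y (pascal_poly a b c d e f) = 0"
      unfolding bracket_eval_pascal_poly[OF Y hex(1)]
    proof (rule det3_eq_0_cong_parallel)
      show "parallel (col Y p) (meet (col Y a) (col Y b) (col Y d) (col Y e))"
        "parallel (col Y q) (meet (col Y b) (col Y c) (col Y e) (col Y f))"
        "parallel (col Y r) (meet (col Y c) (col Y d) (col Y f) (col Y a))"
        by (rule parallel_meet; rule zeroY; fact)+
      show "det3 (col Y p) (col Y q) (col Y r) = 0"
        by (rule zeroY; fact)
      show "{col Y p, col Y q, col Y r} \<subseteq> carrier_vec 3 - {0\<^sub>v 3}"
        using nonzero[of p] nonzero[of q] nonzero[of r] by simp
    qed (simp add: meet_def)
    then show "bracket_eval Y h = 0" by (simp add: h_def)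
  qed
  moreover have "residue_class 3 n h \<notin> nonbasis_ideal 3 n ?x"
  proof
    assume mem: "residue_class 3 n h \<in> nonbasis_ideal 3 n ?x"
    obtain B where B: "B \<in> carrier_mat 3 n"
      and zero: "\<And>j. j < n \<Longrightarrow> j \<notin> {a, b, c, d, e, f} \<Longrightarrow> col B j = 0\<^sub>v 3"
      and one: "bracket_eval B (pascal_poly a b c d e f) = 1" "bracket_eval B (bracket_seq [a, d, e]) = 1"
      using pascal_witness[OF hex] by blast
    have "minor B l = 0" if l: "l \<in> bracket_indices 3 n" "l \<notin> snd (matroid_of 3 n ?x)" for l
    proof -
      obtain x y z where xyz: "l = {x, y, z}" "distinct [x, y, z]" "x < n" "y < n" "z < n"
        using l(1) by (auto simp: bracket_indices_def card_3_iff)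
      have "minor A l = 0" using l bases by simp
      then have "\<not> l \<subseteq> {a, b, c, d, e, f}"
        using generic[of l] l(1) by (auto simp: bracket_indices_def)
      then have "col B x = 0\<^sub>v 3 \<or> col B y = 0\<^sub>v 3 \<or> col B z = 0\<^sub>v 3"
        using zero xyz by blast
      then have "det3 (col B x) (col B y) (col B z) = 0"
        by (auto simp: det3_def)
      then show ?thesis
        using det3_eq_0_iff_minor[OF B xyz(3,4,5,2)] xyz(1) by simp
    qed
    then have "bracket_eval B h = 0"
      by (intro bracket_eval_nonbasis_ideal[OF B _ h mem])
    then show False by (simp add: h_def one)
  qed
  moreover have "residue_class 3 n h \<in> coord_piece 3 n D"
    using h hom by (auto simp: coord_piece_def)
  ultimately show ?thesis by (auto simp: nontrivial_def)
qed

section \<open>Grids of lines over collinear points\<close>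

text \<open>
  Index pairs \<open>(i, j)\<close> of the six points \<open>l\<^sub>i \<inter> m\<^sub>j\<close> with \<open>i \<noteq> j\<close> and \<open>i, j \<le> 3\<close>, in cyclic order: its
  sides lie on \<open>l\<^sub>1, m\<^sub>3, l\<^sub>2, m\<^sub>1, l\<^sub>3, m\<^sub>2\<close>, so that opposite sides meet in \<open>P\<^sub>1, P\<^sub>3, P\<^sub>2\<close>.
\<close>

definition hexagon :: "(nat \<times> nat) set" where
  "hexagon = {(1, 2), (1, 3), (2, 3), (2, 1), (3, 1), (3, 2)}"

text \<open>
  A row or a column of the grid contains only two points of the hexagon, and the diagonal none.
\<close>

lemma hexagon_general_position:
  assumes "s \<in> hexagon" "t \<in> hexagon" "u \<in> hexagon" "distinct [s, t, u]"
  shows "\<not> (fst s = fst t \<and> fst t = fst u \<or> snd s = snd t \<and> snd t = snd u \<or>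
             fst s = snd s \<and> fst t = snd t \<and> fst u = snd u)"
proof -
  have H: "fst v \<in> {1, 2, 3}" "snd v \<in> {1, 2, 3}" "fst v \<noteq> snd v" if "v \<in> hexagon" for v
    using that by (auto simp: hexagon_def)
  show ?thesis
    using H[OF assms(1)] H[OF assms(2)] H[OF assms(3)] assms(4)
    by (cases s, cases t, cases u) (simp, presburger)
qed

locale line_grid =
  fixes k :: nat and P l m :: "nat \<Rightarrow> complex vec set" and L :: "complex vec set"
  assumes two_le_k: "2 \<le> k"
    and L: "L \<in> proj_lines"
    and lines: "i \<in> {1..k} \<Longrightarrow> l i \<in> proj_lines" "i \<in> {1..k} \<Longrightarrow> m i \<in> proj_lines"
    and P: "i \<in> {1..k} \<Longrightarrow> P i \<in> points_on L \<inter> points_on (l i) \<inter> points_on (m i)"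
    and inj_P: "inj_on P {1..k}"
    and finite_grid_points: "finite ((\<Union>i\<in>{1..k}. points_on (l i)) \<inter> (\<Union>i\<in>{1..k}. points_on (m i)))"
    and card_grid_points: "card ((\<Union>i\<in>{1..k}. points_on (l i)) \<inter> (\<Union>i\<in>{1..k}. points_on (m i))) = k\<^sup>2"
    and collinearities: "M \<in> proj_lines \<Longrightarrow>
      card (points_on M \<inter> ((\<Union>i\<in>{1..k}. points_on (l i)) \<inter> (\<Union>i\<in>{1..k}. points_on (m i)))) \<ge> 3 \<Longrightarrow>
      M \<in> l ` {1..k} \<union> m ` {1..k} \<union> {L}"
begin

definition grid_points :: "complex vec set set" where
  "grid_points = (\<Union>i\<in>{1..k}. points_on (l i)) \<inter> (\<Union>i\<in>{1..k}. points_on (m i))"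

definition grid :: "(nat \<times> nat) set" where
  "grid = {1..k} \<times> {1..k}"

definition node :: "nat \<times> nat \<Rightarrow> complex vec set" where
  "node s = (SOME p. p \<in> points_on (l (fst s)) \<inter> points_on (m (snd s)))"

text \<open>
  A common line would make the intersection of the two curves infinite.
\<close>

lemma l_neq_m:
  assumes "i \<in> {1..k}" "j \<in> {1..k}" shows "l i \<noteq> m j"
proof
  assume "l i = m j"
  then have "points_on (l i) \<subseteq> grid_points" using assms by (auto simp: grid_points_def)
  then show False
    using infinite_points_on[OF lines(1)[OF assms(1)]] finite_subset[OF _ finite_grid_points]
    by (simp add: grid_points_def)
qed

lemma node_unique:
  assumes "s \<in> grid" "p \<in> points_on (l (fst s))" "p \<in> points_on (m (snd s))"
  shows "p = node s"
proof -
  have "node s \<in> points_on (l (fst s)) \<inter> points_on (m (snd s))"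
    unfolding node_def by (rule someI[of _ p]) (use assms in simp)
  then show ?thesis
    using proj_line_unique[of "l (fst s)" "m (snd s)" p "node s"] assms lines l_neq_m
    by (fastforce simp: grid_def)
qed

text \<open>
  Distinct lines meet in at most one point, so \<open>k\<^sup>2\<close> pairs of lines give at most \<open>k\<^sup>2\<close> points. As there
  are exactly that many, every pair of lines meets, and different pairs meet in different points.
\<close>

lemma bij_betw_node: "bij_betw node grid grid_points"
  and node_on_lines: "s \<in> grid \<Longrightarrow> node s \<in> points_on (l (fst s)) \<inter> points_on (m (snd s))"
proof -
  define S where "S = {s \<in> grid. points_on (l (fst s)) \<inter> points_on (m (snd s)) \<noteq> {}}"
  have on: "node s \<in> points_on (l (fst s)) \<inter> points_on (m (snd s))" if "s \<in> S" for s
    unfolding node_def by (rule someI_ex) (use that in \<open>auto simp: S_def\<close>)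
  have S: "S \<subseteq> grid" "finite grid" "card grid = k\<^sup>2"
    by (auto simp: S_def grid_def power2_eq_square)
  have sub: "grid_points \<subseteq> node ` S"
  proof
    fix p assume "p \<in> grid_points"
    then obtain i j where ij: "i \<in> {1..k}" "j \<in> {1..k}" "p \<in> points_on (l i)" "p \<in> points_on (m j)"
      by (auto simp: grid_points_def)
    then have "(i, j) \<in> S" by (auto simp: S_def grid_def)
    moreover have "p = node (i, j)" using ij by (intro node_unique) (auto simp: grid_def)
    ultimately show "p \<in> node ` S" by blast
  qed
  have fS: "finite S" using S finite_subset by blast
  have "k\<^sup>2 \<le> card (node ` S)"
    using card_mono[OF _ sub] fS card_grid_points by (simp add: grid_points_def)
  moreover have "card (node ` S) \<le> card S" by (rule card_image_le[OF fS])
  moreover have "card S \<le> k\<^sup>2" using card_mono[OF S(2,1)] S(3) by simp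
  ultimately have c: "card S = k\<^sup>2" "card (node ` S) = card S" by linarith+
  have SG: "S = grid" using card_subset_eq[OF S(2,1)] c S(3) by simp
  moreover have "inj_on node S" using eq_card_imp_inj_on[OF fS c(2)] .
  moreover have "grid_points = node ` S"
    using card_subset_eq[OF _ sub] fS c card_grid_points by (simp add: grid_points_def)
  ultimately show "bij_betw node grid grid_points" by (simp add: bij_betw_def)
  show "s \<in> grid \<Longrightarrow> node s \<in> points_on (l (fst s)) \<inter> points_on (m (snd s))"
    using on SG by simp
qed

lemma node_eq_iff: "s \<in> grid \<Longrightarrow> t \<in> grid \<Longrightarrow> node s = node t \<longleftrightarrow> s = t"
  using bij_betw_node by (auto simp: bij_betw_def inj_on_def)

lemma node_on_l_iff:
  assumes s: "s \<in> grid" and i: "i \<in> {1..k}"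
  shows "node s \<in> points_on (l i) \<longleftrightarrow> fst s = i"
proof
  assume "node s \<in> points_on (l i)"
  moreover have "(i, snd s) \<in> grid" using s i by (auto simp: grid_def)
  ultimately have "node s = node (i, snd s)"
    using node_unique[of "(i, snd s)" "node s"] node_on_lines[OF s] by simp
  then show "fst s = i" using node_eq_iff[OF s \<open>(i, snd s) \<in> grid\<close>] by (metis fst_conv)
qed (use node_on_lines[OF s] in auto)

lemma node_on_m_iff:
  assumes s: "s \<in> grid" and i: "i \<in> {1..k}"
  shows "node s \<in> points_on (m i) \<longleftrightarrow> snd s = i"
proof
  assume "node s \<in> points_on (m i)"
  moreover have "(fst s, i) \<in> grid" using s i by (auto simp: grid_def)
  ultimately have "node s = node (fst s, i)"
    using node_unique[of "(fst s, i)" "node s"] node_on_lines[OF s] by simp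
  then show "snd s = i" using node_eq_iff[OF s \<open>(fst s, i) \<in> grid\<close>] by (metis snd_conv)
qed (use node_on_lines[OF s] in auto)

lemma P_eq_node: "i \<in> {1..k} \<Longrightarrow> P i = node (i, i)"
  using node_unique[of "(i, i)" "P i"] P[of i] by (auto simp: grid_def)

text \<open>
  Otherwise \<open>l\<^sub>i\<close> would contain all diagonal points, but it contains only those of row \<open>i\<close>.
\<close>

lemma l_neq_L:
  assumes i: "i \<in> {1..k}" shows "l i \<noteq> L"
proof
  assume eq: "l i = L"
  obtain j where j: "j \<in> {1..k}" "j \<noteq> i"
  proof (cases "i = 1")
    case True then show thesis using that[of 2] two_le_k by auto
  next
    case False then show thesis using that[of 1] two_le_k by auto
  qed
  then have "node (j, j) \<in> points_on (l i)" using P[of j] P_eq_node[of j] eq by simp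
  then show False using node_on_l_iff[of "(j, j)" i] i j by (auto simp: grid_def)
qed

lemma node_on_L_iff:
  assumes s: "s \<in> grid"
  shows "node s \<in> points_on L \<longleftrightarrow> fst s = snd s"
proof
  let ?i = "fst s"
  assume "node s \<in> points_on L"
  have i: "?i \<in> {1..k}" "(?i, ?i) \<in> grid" using s by (auto simp: grid_def)
  have "node s = node (?i, ?i)"
  proof (rule ccontr)
    assume "node s \<noteq> node (?i, ?i)"
    moreover have "node (?i, ?i) \<in> points_on L" "node (?i, ?i) \<in> points_on (l ?i)"
      using P[OF i(1)] P_eq_node[OF i(1)] by auto
    ultimately have "L = l ?i"
      using proj_line_unique[OF L lines(1)[OF i(1)]] \<open>node s \<in> points_on L\<close> node_on_lines[OF s] by blast
    then show False using l_neq_L[OF i(1)] by simp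
  qed
  then show "fst s = snd s" using node_eq_iff[OF s i(2)] by (auto simp: prod_eq_iff)
next
  assume "fst s = snd s"
  then show "node s \<in> points_on L"
    using s P[of "fst s"] P_eq_node[of "fst s"] by (auto simp: grid_def)
qed

text \<open>
  The collinear triples are thus determined by the positions in the grid: the points in a row lie on
  a line \<open>l\<^sub>i\<close>, those in a column on a line \<open>m\<^sub>j\<close>, those on the diagonal are the \<open>P\<^sub>i\<close> on \<open>L\<close>.
\<close>

lemma nodes_collinear_iff:
  assumes "s \<in> grid" "t \<in> grid" "u \<in> grid" "distinct [s, t, u]"
  shows "(\<exists>M\<in>proj_lines. {node s, node t, node u} \<subseteq> points_on M) \<longleftrightarrow>
     fst s = fst t \<and> fst t = fst u \<or> snd s = snd t \<and> snd t = snd u \<or>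
     fst s = snd s \<and> fst t = snd t \<and> fst u = snd u"
    (is "?col \<longleftrightarrow> ?row \<or> ?column \<or> ?diagonal")
proof
  assume ?col
  then obtain M where M: "M \<in> proj_lines" "{node s, node t, node u} \<subseteq> points_on M" by blast
  have "{node s, node t, node u} \<subseteq> points_on M \<inter> grid_points"
    using M(2) assms bij_betw_node by (auto simp: bij_betw_def)
  moreover have "card {node s, node t, node u} = 3"
    using assms by (simp add: node_eq_iff)
  ultimately have "3 \<le> card (points_on M \<inter> grid_points)"
    using finite_grid_points by (metis card_mono finite_Int grid_points_def)
  then have "M \<in> l ` {1..k} \<union> m ` {1..k} \<union> {L}"
    using collinearities[OF M(1)] by (simp add: grid_points_def)
  then consider i where "i \<in> {1..k}" "M = l i" | i where "i \<in> {1..k}" "M = m i" | "M = L"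
    by blast
  then show "?row \<or> ?column \<or> ?diagonal"
    by cases (use M(2) assms node_on_l_iff node_on_m_iff node_on_L_iff in auto)
next
  have "fst s \<in> {1..k}" "snd s \<in> {1..k}" using assms(1) by (auto simp: grid_def)
  moreover assume "?row \<or> ?column \<or> ?diagonal"
  ultimately consider "{node s, node t, node u} \<subseteq> points_on (l (fst s))"
    | "{node s, node t, node u} \<subseteq> points_on (m (snd s))" | "{node s, node t, node u} \<subseteq> points_on L"
    using assms node_on_l_iff node_on_m_iff node_on_L_iff by auto
  then show ?col
    using lines[of "fst s"] lines[of "snd s"] L \<open>fst s \<in> {1..k}\<close> \<open>snd s \<in> {1..k}\<close>
    by cases blast+
qed

lemma column_index:
  assumes A: "A \<in> carrier_mat 3 (k\<^sup>2)"
    and bij: "bij_betw (\<lambda>j. proj_point (col A j)) {..<k\<^sup>2} grid_points"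
  obtains x where "x ` grid \<subseteq> {..<k\<^sup>2}" "inj_on x grid"
    "\<And>s t u. s \<in> grid \<Longrightarrow> t \<in> grid \<Longrightarrow> u \<in> grid \<Longrightarrow> distinct [s, t, u] \<Longrightarrow>
       det3 (col A (x s)) (col A (x t)) (col A (x u)) = 0 \<longleftrightarrow>
       fst s = fst t \<and> fst t = fst u \<or> snd s = snd t \<and> snd t = snd u \<or>
       fst s = snd s \<and> fst t = snd t \<and> fst u = snd u"
proof -
  define x where "x = the_inv_into {..<k\<^sup>2} (\<lambda>j. proj_point (col A j)) \<circ> node"
  have bij_x: "bij_betw x grid {..<k\<^sup>2}"
    unfolding x_def using bij_betw_trans[OF bij_betw_node bij_betw_the_inv_into[OF bij]] .
  have x: "proj_point (col A (x s)) = node s" "col A (x s) \<in> carrier_vec 3"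
    "node s \<in> proj_points" if "s \<in> grid" for s
  proof -
    have "node s \<in> grid_points" using bij_betw_node that by (auto simp: bij_betw_def)
    then show "proj_point (col A (x s)) = node s"
      using f_the_inv_into_f_bij_betw[OF bij, of "node s"] by (simp add: x_def)
    have "x s < k\<^sup>2" using bij_betwE[OF bij_x] that by auto
    then show "col A (x s) \<in> carrier_vec 3" using A by simp
    show "node s \<in> proj_points" using node_on_lines[OF that] by (simp add: points_on_def)
  qed
  show thesis
  proof (rule that)
    show "x ` grid \<subseteq> {..<k\<^sup>2}" "inj_on x grid" using bij_x by (simp_all add: bij_betw_def)
    fix s t u assume stu: "s \<in> grid" "t \<in> grid" "u \<in> grid" "distinct [s, t, u]"
    note xs = x[OF stu(1)] x[OF stu(2)] x[OF stu(3)]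
    have "node s \<noteq> node t" using node_eq_iff[OF stu(1,2)] stu(4) by simp
    then have "det3 (col A (x s)) (col A (x t)) (col A (x u)) = 0 \<longleftrightarrow>
        (\<exists>M\<in>proj_lines. {node s, node t, node u} \<subseteq> points_on M)"
      using collinear_iff_det3[OF xs(2,5,8)] xs(3,6,9) unfolding xs(1,4,7) by blast
    then show "det3 (col A (x s)) (col A (x t)) (col A (x u)) = 0 \<longleftrightarrow>
       fst s = fst t \<and> fst t = fst u \<or> snd s = snd t \<and> snd t = snd u \<or>
       fst s = snd s \<and> fst t = snd t \<and> fst u = snd u"
      unfolding nodes_collinear_iff[OF stu] .
  qed
qed

lemma ex_nontrivial:
  assumes k: "3 \<le> k" and D: "4 \<le> D" and A: "A \<in> carrier_mat 3 (k\<^sup>2)"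
    and bij: "bij_betw (\<lambda>j. proj_point (col A j)) {..<k\<^sup>2} grid_points"
  shows "\<exists>F\<in>coord_piece 3 (k\<^sup>2) D. nontrivial 3 (k\<^sup>2) (vec_space.row_space (k\<^sup>2) A) F"
proof -
  obtain x where x: "x ` grid \<subseteq> {..<k\<^sup>2}" "inj_on x grid" and
    col: "\<And>s t u. s \<in> grid \<Longrightarrow> t \<in> grid \<Longrightarrow> u \<in> grid \<Longrightarrow> distinct [s, t, u] \<Longrightarrow>
       det3 (col A (x s)) (col A (x t)) (col A (x u)) = 0 \<longleftrightarrow>
       fst s = fst t \<and> fst t = fst u \<or> snd s = snd t \<and> snd t = snd u \<or>
       fst s = snd s \<and> fst t = snd t \<and> fst u = snd u"
    using column_index[OF A bij] by blast
  have g: "(i, j) \<in> grid" if "i \<in> {1, 2, 3}" "j \<in> {1, 2, 3}" for i j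
    using that k by (auto simp: grid_def)
  have lt: "x (i, j) < k\<^sup>2" if "i \<in> {1, 2, 3}" "j \<in> {1, 2, 3}" for i j
    using x(1) g[OF that] by auto
  have H: "hexagon \<subseteq> grid" unfolding hexagon_def using g by simp
  have xH: "x ` hexagon = {x (1, 2), x (1, 3), x (2, 3), x (2, 1), x (3, 1), x (3, 2)}"
    by (simp add: hexagon_def)
  have "distinct (map x [(1, 2), (1, 3), (2, 3), (2, 1), (3, 1), (3, 2)])"
    unfolding distinct_map using inj_on_subset[OF x(2) H] by (simp add: hexagon_def)
  then have hex: "distinct [x (1, 2), x (1, 3), x (2, 3), x (2, 1), x (3, 1), x (3, 2)]"
    by (simp only: list.map)
  have generic: "minor A l \<noteq> 0" if l: "l \<subseteq> x ` hexagon" "card l = 3" for l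
  proof -
    obtain T where T: "T \<subseteq> hexagon" "l = x ` T" using l(1) by (meson subset_imageE)
    have "inj_on x T" using inj_on_subset[OF x(2)] T(1) H by blast
    then have "card T = 3" using l(2) T(2) by (simp add: card_image)
    then obtain s t u where stu: "T = {s, t, u}" "distinct [s, t, u]"
      by (auto simp: card_3_iff)
    have in_H: "s \<in> hexagon" "t \<in> hexagon" "u \<in> hexagon" using T(1) stu(1) by auto
    then have in_grid: "s \<in> grid" "t \<in> grid" "u \<in> grid" using H by blast+
    have "det3 (col A (x s)) (col A (x t)) (col A (x u)) \<noteq> 0"
      using col[OF in_grid stu(2)] hexagon_general_position[OF in_H stu(2)] by blast
    moreover have "distinct [x s, x t, x u]"
      using stu(2) in_grid x(2) by (simp add: inj_on_eq_iff)
    moreover have "x s < k\<^sup>2" "x t < k\<^sup>2" "x u < k\<^sup>2" using in_grid x(1) by auto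
    ultimately show ?thesis
      using det3_eq_0_iff_minor[OF A] T(2) stu(1) by simp
  qed
  have zero: "det3 (col A (x (i, j))) (col A (x (i', j'))) (col A (x (i'', j''))) = 0"
    if "i \<in> {1, 2, 3}" "j \<in> {1, 2, 3}" "i' \<in> {1, 2, 3}" "j' \<in> {1, 2, 3}"
      "i'' \<in> {1, 2, 3}" "j'' \<in> {1, 2, 3}" "distinct [(i, j), (i', j'), (i'', j'')]"
      "i = i' \<and> i' = i'' \<or> j = j' \<and> j' = j'' \<or> i = j \<and> i' = j' \<and> i'' = j''"
    for i j i' j' i'' j''
    using col[OF g[OF that(1,2)] g[OF that(3,4)] g[OF that(5,6)] that(7)] that(8) by simp
  have nonzero: "\<exists>t<k\<^sup>2. \<exists>u<k\<^sup>2. det3 (col A s) (col A t) (col A u) \<noteq> 0"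
    if "s \<in> {x (1, 1), x (3, 3), x (2, 2)}" for s
  proof -
    have "\<exists>i\<in>{1, 2, 3}. s = x (i, i)" using that by auto
    then obtain i where i: "i \<in> {1, 2, 3}" "s = x (i, i)" by blast
    \<comment> \<open>The nodes (1, 2) and (2, 3) share no row or column with each other and are off the diagonal.\<close>
    have "distinct [(i, i), (1, 2), (2, 3)]" by auto
    moreover have "(1, 2) \<in> grid" "(2, 3) \<in> grid" by (rule g; simp)+
    ultimately have "det3 (col A s) (col A (x (1, 2))) (col A (x (2, 3))) \<noteq> 0"
      using col[OF g[OF i(1) i(1)], of "(1, 2)" "(2, 3)"] i(2) by simp
    moreover have "x (1, 2) < k\<^sup>2" "x (2, 3) < k\<^sup>2" by (rule lt; simp)+
    ultimately show ?thesis by blast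
  qed
  show ?thesis
  proof (rule nontrivial_pascal_multiple[OF A])
    show "{x (1, 2), x (1, 3), x (2, 3), x (2, 1), x (3, 1), x (3, 2)} \<subseteq> {..<k\<^sup>2}"
      using x(1) H unfolding xH[symmetric] by blast
    show "distinct [x (1, 2), x (1, 3), x (2, 3), x (2, 1), x (3, 1), x (3, 2)]" by (fact hex)
    show "minor A l \<noteq> 0"
      if "l \<subseteq> {x (1, 2), x (1, 3), x (2, 3), x (2, 1), x (3, 1), x (3, 2)}" "card l = 3" for l
      using generic[of l] that unfolding xH by blast
    show "x (1, 1) < k\<^sup>2" "x (3, 3) < k\<^sup>2" "x (2, 2) < k\<^sup>2" by (rule lt; simp)+
    show "\<exists>t<k\<^sup>2. \<exists>u<k\<^sup>2. det3 (col A s) (col A t) (col A u) \<noteq> 0"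
      if "s \<in> {x (1, 1), x (3, 3), x (2, 2)}" for s
      by (rule nonzero[OF that])
  qed (rule zero D; simp)+
qed

end

section \<open>The nontrivial polynomial\<close>

theorem theorem4p3p4:
  fixes k :: nat
    and P l m :: "nat \<Rightarrow> complex vec set"
    and L :: "complex vec set"
    and C D :: "complex vec set set"
    and A :: "complex mat"
  assumes "k > 3"
    and "\<And>i. i \<in> {1..k} \<Longrightarrow> P i \<in> proj_points"
    and "inj_on P {1..k}"
    and "L \<in> proj_lines" and "\<And>i. i \<in> {1..k} \<Longrightarrow> P i \<in> points_on L"
    and "\<And>i. i \<in> {1..k} \<Longrightarrow> l i \<in> proj_lines \<and> P i \<in> points_on (l i)"
    and "\<And>i. i \<in> {1..k} \<Longrightarrow> m i \<in> proj_lines \<and> P i \<in> points_on (m i)"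
    and "C = (\<Union>i\<in>{1..k}. points_on (l i))"
    and "D = (\<Union>i\<in>{1..k}. points_on (m i))"
    and "finite (C \<inter> D)" and "card (C \<inter> D) = k\<^sup>2"
    and "\<And>M. M \<in> proj_lines \<Longrightarrow> card (points_on M \<inter> (C \<inter> D)) \<ge> 3 \<Longrightarrow>
           M \<in> l ` {1..k} \<union> m ` {1..k} \<union> {L}"
    and "A \<in> carrier_mat 3 (k\<^sup>2)"
    and "bij_betw (\<lambda>j. proj_point (col A j)) {..<k\<^sup>2} (C \<inter> D)"
  shows "\<exists>F \<in> coord_piece 3 (k\<^sup>2) ((k + 1) choose 3).
           nontrivial 3 (k\<^sup>2) (vec_space.row_space (k\<^sup>2) A) F"
proof -
  interpret line_grid k P l m L
    by unfold_locales (use assms in \<open>auto simp del: One_nat_def\<close>)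
  have "4 choose 3 \<le> (k + 1) choose 3"
    using assms(1) by (intro binomial_right_mono) simp
  then have "4 \<le> (k + 1) choose 3" by (simp add: eval_nat_numeral)
  then show ?thesis
    using assms by (intro ex_nontrivial) (auto simp: grid_points_def)
qed

end
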